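(* Let $S$ be a finitely generated semigroup, let $Gr(S)$ be the finitely generated group obtained by interpreting a semigroup presentation of $S$ as a presentation of a group, and let $\eta_S: S \to Gr(S)$ be the natural semigroup homomorphism (so $\eta_S(S)$ generates $Gr(S)$ as a group). Let $k\ge 1$. There exists a finite canonical collection of (limit) pairs $(S_1,L_1),\ldots,(S_m,L_m)$, where the $L_i$ are limit groups that are quotients of $Gr(S)$, and the semigroups $S_i$ are quotients of $S$ that are subsemigroups of $L_i$ generating $L_i$ as groups, with the following properties: (1) for each index $i$, $1 \leq i \leq m$, there exists a (canonical) quotient map of pairs $\tau_i:(S,Gr(S)) \to (S_i,L_i)$. (2) every homomorphism of semigroups $h:S \to FS_k$ extends to a map of pairs $h_P:(S,Gr(S)) \to (FS_k,F_k)$, and for each such $h$ there exist an index $i$, $1 \leq i \leq m$, and a homomorphism of pairs $u_h:(S_i,L_i) \to (FS_k,F_k)$ for which $h_P=u_h \circ \tau_i$.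
   Context: $FS_k$ is the free semigroup on $a_1,\ldots,a_k$, embedded in the standard way (as positive words) in the free group $F_k$ on $a_1,\ldots,a_k$. A pair $(S,G)$ consists of a group $G$ and a semigroup $S$ given with a homomorphism to $G$ (usually an inclusion) whose image generates $G$ as a group; for $(S,Gr(S))$ the homomorphism is $\eta_S$. A homomorphism of pairs $(S,G)\to(S',G')$ is a group homomorphism $G\to G'$ mapping (the image of) $S$ into (the image of) $S'$; a quotient map of pairs is one that is surjective both on the groups and on the semigroups. A limit group is a finitely generated fully residually free group. A pair $(S_i,L_i)$ is a limit pair if $L_i$ is a limit group and $(S_i,L_i)$ is obtained as a limit of a sequence of pair homomorphisms into $(FS_k,F_k)$. *)

theory Defs
  imports "HOL-Algebra.Generated_Groups"
begin

section \<open>Semigroups and semigroup presentations\<close>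

text \<open>
  HOL-Algebra has no structure for semigroups. A semigroup is represented here by a monoid record
  whose \<open>one\<close> component is never looked at; this makes \<^const>\<open>hom\<close> and \<^const>\<open>iso\<close>, which only
  mention the carrier and the multiplication, the semigroup homomorphisms and isomorphisms.
\<close>

definition is_semigroup :: "('a, 'b) monoid_scheme \<Rightarrow> bool" where
  "is_semigroup S \<longleftrightarrow>
     (\<forall>x\<in>carrier S. \<forall>y\<in>carrier S. x \<otimes>\<^bsub>S\<^esub> y \<in> carrier S) \<and>
     (\<forall>x\<in>carrier S. \<forall>y\<in>carrier S. \<forall>z\<in>carrier S.
        (x \<otimes>\<^bsub>S\<^esub> y) \<otimes>\<^bsub>S\<^esub> z = x \<otimes>\<^bsub>S\<^esub> (y \<otimes>\<^bsub>S\<^esub> z))"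

inductive_set semigroup_span :: "('a, 'b) monoid_scheme \<Rightarrow> 'a set \<Rightarrow> 'a set" for S A where
  incl: "a \<in> A \<Longrightarrow> a \<in> semigroup_span S A"
| mult: "a \<in> semigroup_span S A \<Longrightarrow> b \<in> semigroup_span S A \<Longrightarrow>
    a \<otimes>\<^bsub>S\<^esub> b \<in> semigroup_span S A"

definition fg_semigroup :: "('a, 'b) monoid_scheme \<Rightarrow> bool" where
  "fg_semigroup S \<longleftrightarrow>
     is_semigroup S \<and> (\<exists>A. finite A \<and> A \<subseteq> carrier S \<and> semigroup_span S A = carrier S)"

definition subsemigroup :: "'a set \<Rightarrow> ('a, 'b) monoid_scheme \<Rightarrow> bool" where
  "subsemigroup T S \<longleftrightarrow> T \<subseteq> carrier S \<and> (\<forall>x\<in>T. \<forall>y\<in>T. x \<otimes>\<^bsub>S\<^esub> y \<in> T)"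

definition free_semigroup :: "'x set \<Rightarrow> 'x list monoid" where
  "free_semigroup X = \<lparr>carrier = lists X - {[]}, mult = (@), one = undefined\<rparr>"

text \<open>The relators are pairs \<open>(u, v)\<close> of nonempty words, standing for the relation \<open>u = v\<close>.\<close>

definition semigroup_relations :: "'x set \<Rightarrow> ('x list \<times> 'x list) set \<Rightarrow> bool" where
  "semigroup_relations X R \<longleftrightarrow> R \<subseteq> (lists X - {[]}) \<times> (lists X - {[]})"

inductive_set semigroup_cong :: "'x set \<Rightarrow> ('x list \<times> 'x list) set \<Rightarrow> ('x list \<times> 'x list) set"
  for X R where
  rel: "(u, v) \<in> R \<Longrightarrow> (u, v) \<in> semigroup_cong X R"
| refl: "w \<in> lists X - {[]} \<Longrightarrow> (w, w) \<in> semigroup_cong X R"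
| sym: "(u, v) \<in> semigroup_cong X R \<Longrightarrow> (v, u) \<in> semigroup_cong X R"
| trans: "(u, v) \<in> semigroup_cong X R \<Longrightarrow> (v, w) \<in> semigroup_cong X R \<Longrightarrow>
    (u, w) \<in> semigroup_cong X R"
| mult: "(u, v) \<in> semigroup_cong X R \<Longrightarrow> (u', v') \<in> semigroup_cong X R \<Longrightarrow>
    (u @ u', v @ v') \<in> semigroup_cong X R"

definition presented_semigroup :: "'x set \<Rightarrow> ('x list \<times> 'x list) set \<Rightarrow> 'x list set monoid" where
  "presented_semigroup X R =
     \<lparr>carrier = (lists X - {[]}) // semigroup_cong X R,
      mult = (\<lambda>A B. \<Union>a\<in>A. \<Union>b\<in>B. semigroup_cong X R `` {a @ b}),
      one = undefined\<rparr>"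


section \<open>Free groups and group presentations\<close>

text \<open>
  Group words are lists of signed letters: \<open>(True, x)\<close> stands for \<open>x\<close> and \<open>(False, x)\<close> for its
  formal inverse. The relators are pairs of group words, as for semigroups.
\<close>

type_synonym 'x gword = "(bool \<times> 'x) list"

inductive_set group_cong :: "'x set \<Rightarrow> ('x gword \<times> 'x gword) set \<Rightarrow> ('x gword \<times> 'x gword) set"
  for X R where
  rel: "(u, v) \<in> R \<Longrightarrow> (u, v) \<in> group_cong X R"
| cancel: "x \<in> X \<Longrightarrow> ([(b, x), (\<not> b, x)], []) \<in> group_cong X R"
| refl: "w \<in> lists (UNIV \<times> X) \<Longrightarrow> (w, w) \<in> group_cong X R"
| sym: "(u, v) \<in> group_cong X R \<Longrightarrow> (v, u) \<in> group_cong X R"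
| trans: "(u, v) \<in> group_cong X R \<Longrightarrow> (v, w) \<in> group_cong X R \<Longrightarrow> (u, w) \<in> group_cong X R"
| mult: "(u, v) \<in> group_cong X R \<Longrightarrow> (u', v') \<in> group_cong X R \<Longrightarrow>
    (u @ u', v @ v') \<in> group_cong X R"

definition presented_group :: "'x set \<Rightarrow> ('x gword \<times> 'x gword) set \<Rightarrow> 'x gword set monoid" where
  "presented_group X R =
     \<lparr>carrier = lists (UNIV \<times> X) // group_cong X R,
      mult = (\<lambda>A B. \<Union>a\<in>A. \<Union>b\<in>B. group_cong X R `` {a @ b}),
      one = group_cong X R `` {[]}\<rparr>"

definition free_group :: "'x set \<Rightarrow> 'x gword set monoid" where
  "free_group X = presented_group X {}"

definition pos_word :: "'x list \<Rightarrow> 'x gword" where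
  "pos_word w = map (Pair True) w"

definition pos_rels :: "('x list \<times> 'x list) set \<Rightarrow> ('x gword \<times> 'x gword) set" where
  "pos_rels R = map_prod pos_word pos_word ` R"

text \<open>
  For a semigroup \<open>S\<close> identified by \<open>\<psi>\<close> with the semigroup presented by \<open>\<langle>X | R\<rangle>\<close>, the group \<open>Gr(S)\<close>
  is the group with the same presentation, and \<open>\<eta>\<^sub>S\<close> sends an element represented by the positive
  word \<open>w\<close> to the element of the group represented by \<open>w\<close>. (All words \<open>w\<close> in a class \<open>\<psi> s\<close> give
  the same group element, so the union in \<open>eta\<close> is a single coset.)
\<close>

definition Gr :: "'x set \<Rightarrow> ('x list \<times> 'x list) set \<Rightarrow> 'x gword set monoid" where
  "Gr X R = presented_group X (pos_rels R)"

definition eta ::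
  "'x set \<Rightarrow> ('x list \<times> 'x list) set \<Rightarrow> ('s \<Rightarrow> 'x list set) \<Rightarrow> 's \<Rightarrow> 'x gword set" where
  "eta X R \<psi> s = (\<Union>w\<in>\<psi> s. group_cong X (pos_rels R) `` {pos_word w})"

definition free_incl :: "'x set \<Rightarrow> 'x list \<Rightarrow> 'x gword set" where
  "free_incl X w = group_cong X {} `` {pos_word w}"


section \<open>Limit groups\<close>

definition fg_group :: "('a, 'b) monoid_scheme \<Rightarrow> bool" where
  "fg_group G \<longleftrightarrow> (\<exists>A. finite A \<and> A \<subseteq> carrier G \<and> generate G A = carrier G)"

text \<open>
  Free groups on sets of natural numbers suffice as targets below: the notion is used for finitely
  generated (hence countable) groups only.
\<close>

definition fully_residually_free :: "('a, 'b) monoid_scheme \<Rightarrow> bool" where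
  "fully_residually_free G \<longleftrightarrow>
     (\<forall>A. finite A \<and> A \<subseteq> carrier G - {\<one>\<^bsub>G\<^esub>} \<longrightarrow>
       (\<exists>(Y :: nat set). \<exists>\<phi>\<in>hom G (free_group Y). \<forall>a\<in>A. \<phi> a \<noteq> \<one>\<^bsub>free_group Y\<^esub>))"

definition limit_group :: "('a, 'b) monoid_scheme \<Rightarrow> bool" where
  "limit_group G \<longleftrightarrow> group G \<and> fg_group G \<and> fully_residually_free G"


section \<open>Pairs\<close>

record ('s, 'g) pair =
  sgp :: "'s monoid"
  grp :: "'g monoid"
  str :: "'s \<Rightarrow> 'g"

definition is_pair :: "('s, 'g) pair \<Rightarrow> bool" where
  "is_pair P \<longleftrightarrow> is_semigroup (sgp P) \<and> group (grp P) \<and> str P \<in> hom (sgp P) (grp P) \<and>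
     generate (grp P) (str P ` carrier (sgp P)) = carrier (grp P)"

definition sgp_image :: "('s, 'g) pair \<Rightarrow> 'g set" where
  "sgp_image P = str P ` carrier (sgp P)"

definition pair_hom :: "('s, 'g) pair \<Rightarrow> ('t, 'l) pair \<Rightarrow> ('g \<Rightarrow> 'l) set" where
  "pair_hom P Q = {\<phi> \<in> hom (grp P) (grp Q). \<phi> ` sgp_image P \<subseteq> sgp_image Q}"

definition pair_quotient_map :: "('s, 'g) pair \<Rightarrow> ('t, 'l) pair \<Rightarrow> ('g \<Rightarrow> 'l) set" where
  "pair_quotient_map P Q =
     {\<phi> \<in> pair_hom P Q. \<phi> ` carrier (grp P) = carrier (grp Q) \<and> \<phi> ` sgp_image P = sgp_image Q}"

definition Gr_pair :: "'s monoid \<Rightarrow> 'x set \<Rightarrow> ('x list \<times> 'x list) set \<Rightarrow> ('s \<Rightarrow> 'x list set) \<Rightarrow>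
    ('s, 'x gword set) pair" where
  "Gr_pair S X R \<psi> = \<lparr>sgp = S, grp = Gr X R, str = eta X R \<psi>\<rparr>"

definition free_pair :: "nat \<Rightarrow> (nat list, nat gword set) pair" where
  "free_pair k =
     \<lparr>sgp = free_semigroup {..<k}, grp = free_group {..<k}, str = free_incl {..<k}\<rparr>"

text \<open>A subsemigroup \<open>T\<close> of a group \<open>L\<close>, paired with \<open>L\<close> through the inclusion map.\<close>

definition incl_pair :: "'l set \<Rightarrow> 'l monoid \<Rightarrow> ('l, 'l) pair" where
  "incl_pair T L = \<lparr>sgp = L\<lparr>carrier := T\<rparr>, grp = L, str = (\<lambda>x. x)\<rparr>"


section \<open>Limit pairs\<close>

text \<open>
  A sequence of pair homomorphisms converges if every element of the source group is eventually
  killed or eventually not killed. Its limit is the quotient of the source pair whose kernel is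
  the stable kernel, that is, the set of the elements that are eventually killed.
\<close>

definition convergent_seq ::
  "('s, 'g) pair \<Rightarrow> ('t, 'l) pair \<Rightarrow> (nat \<Rightarrow> 'g \<Rightarrow> 'l) \<Rightarrow> bool" where
  "convergent_seq P Q h \<longleftrightarrow> (\<forall>n. h n \<in> pair_hom P Q) \<and>
     (\<forall>g\<in>carrier (grp P).
        (\<forall>\<^sub>F n in sequentially. h n g = \<one>\<^bsub>grp Q\<^esub>) \<or>
        (\<forall>\<^sub>F n in sequentially. h n g \<noteq> \<one>\<^bsub>grp Q\<^esub>))"

definition stable_kernel ::
  "('s, 'g) pair \<Rightarrow> ('t, 'l) pair \<Rightarrow> (nat \<Rightarrow> 'g \<Rightarrow> 'l) \<Rightarrow> 'g set" where
  "stable_kernel P Q h = {g \<in> carrier (grp P). \<forall>\<^sub>F n in sequentially. h n g = \<one>\<^bsub>grp Q\<^esub>}"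

text \<open>\<open>limit_pair k P Q \<tau>\<close>: the pair \<open>Q\<close> is a limit pair, obtained as the limit of pair homomorphisms
  from \<open>P\<close> to \<open>(FS\<^sub>k, F\<^sub>k)\<close>, with limit quotient map \<open>\<tau>\<close>.\<close>

definition limit_pair ::
  "nat \<Rightarrow> ('s, 'g) pair \<Rightarrow> ('t, 'l) pair \<Rightarrow> ('g \<Rightarrow> 'l) \<Rightarrow> bool" where
  "limit_pair k P Q \<tau> \<longleftrightarrow> is_pair Q \<and> limit_group (grp Q) \<and> \<tau> \<in> pair_quotient_map P Q \<and>
     (\<exists>h. convergent_seq P (free_pair k) h \<and>
          kernel (grp P) (grp Q) \<tau> = stable_kernel P (free_pair k) h)"


section \<open>The canonical collection of limit pairs\<close>

text \<open>
  Quotients \<open>\<tau>\<^sub>1 : P \<rightarrow> Q\<^sub>1\<close> and \<open>\<tau>\<^sub>2 : P \<rightarrow> Q\<^sub>2\<close> of a pair are preordered by domination: \<open>\<tau>\<^sub>2\<close> factors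
  through \<open>\<tau>\<^sub>1\<close>. Mutual domination is isomorphism of pairs under \<open>P\<close>.
\<close>

definition dominates ::
  "('s, 'g) pair \<Rightarrow> ('t, 'l) pair \<Rightarrow> ('g \<Rightarrow> 'l) \<Rightarrow> ('u, 'm) pair \<Rightarrow> ('g \<Rightarrow> 'm) \<Rightarrow> bool" where
  "dominates P Q\<^sub>1 \<tau>\<^sub>1 Q\<^sub>2 \<tau>\<^sub>2 \<longleftrightarrow>
     (\<exists>u\<in>pair_hom Q\<^sub>1 Q\<^sub>2. \<forall>g\<in>carrier (grp P). \<tau>\<^sub>2 g = u (\<tau>\<^sub>1 g))"

text \<open>
  The competing limit pairs live on the type of the given one. When that is the type of sets of
  elements of \<open>grp P\<close>, every quotient of \<open>P\<close> occurs there up to isomorphism (as a group of cosets).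
\<close>

definition maximal_limit_pair ::
  "nat \<Rightarrow> ('s, 'g) pair \<Rightarrow> 'l set \<Rightarrow> 'l monoid \<Rightarrow> ('g \<Rightarrow> 'l) \<Rightarrow> bool" where
  "maximal_limit_pair k P T L \<tau> \<longleftrightarrow> limit_pair k P (incl_pair T L) \<tau> \<and>
     (\<forall>T' L' (\<tau>' :: 'g \<Rightarrow> 'l).
        limit_pair k P (incl_pair T' L') \<tau>' \<and>
        dominates P (incl_pair T' L') \<tau>' (incl_pair T L) \<tau> \<longrightarrow>
        dominates P (incl_pair T L) \<tau> (incl_pair T' L') \<tau>')"

text \<open>
  The canonical collection attached to \<open>P\<close> and \<open>k\<close> consists of the maximal limit quotients of \<open>P\<close>,
  one for each isomorphism class under \<open>P\<close>. This determines the collection, together with its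
  quotient maps, up to reordering and isomorphism under \<open>P\<close>.
\<close>

definition canonical_collection ::
  "nat \<Rightarrow> ('s, 'g) pair \<Rightarrow> 'i set \<Rightarrow>
   ('i \<Rightarrow> 'l set) \<Rightarrow> ('i \<Rightarrow> 'l monoid) \<Rightarrow> ('i \<Rightarrow> 'g \<Rightarrow> 'l) \<Rightarrow> bool" where
  "canonical_collection k P I T L \<tau> \<longleftrightarrow>
     (\<forall>i\<in>I. maximal_limit_pair k P (T i) (L i) (\<tau> i)) \<and>
     (\<forall>T' L' (\<tau>' :: 'g \<Rightarrow> 'l). maximal_limit_pair k P T' L' \<tau>' \<longrightarrow>
        (\<exists>!i. i \<in> I \<and>
           dominates P (incl_pair (T i) (L i)) (\<tau> i) (incl_pair T' L') \<tau>' \<and>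
           dominates P (incl_pair T' L') \<tau>' (incl_pair (T i) (L i)) (\<tau> i)))"

end

theory Submission
  imports Defs Complex_Main "HOL-Library.Function_Algebras" "HOL-Library.Countable_Set"
begin

text \<open>
  The free group \<open>F\<^sub>k\<close> is equationally Noetherian: it acts faithfully by real \<open>2 \<times> 2\<close> matrices, so by
  Hilbert's basis theorem every set \<open>K\<close> of elements of a finitely generated group \<open>G\<close> has a finite subset
  that is killed by the same homomorphisms \<open>G \<rightarrow> F\<^sub>k\<close> as \<open>K\<close>. Consequently the kernels of limits of pair
  homomorphisms are the sets \<open>K\<close> such that, for each finite set \<open>A\<close> of elements outside \<open>K\<close>, a single pair
  homomorphism kills \<open>K\<close> and no element of \<open>A\<close>; these play the role of irreducible closed sets. As in
  any Noetherian space, finitely many of them account for all pair homomorphisms, and the minimal ones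
  among these are all the minimal ones. Their quotients form the canonical collection.
\<close>

section \<open>Noetherian subrings\<close>

text \<open>Positivity enters the finiteness argument only by selecting a set of homomorphisms: a
  finite subsystem that works for all homomorphisms \<open>G \<rightarrow> F\<close> works for any
  subset of them. Factorization costs nothing on the semigroup side either, because the semigroup of
  each quotient is the image of \<open>S\<close>, so the induced map is positive wherever the
  original one is.

  The obstacle in the definition of a limit is that each element of the stable kernel may be killed
  from a different index on. A finite subsystem makes the index uniform, so a sequence can be traded
  for the separation condition \<open>limit_kernel\<close>. Countability of \<open>G\<close> gives
  the way back: the elements to be kept alive are listed, and the \<open>n\<close>-th homomorphism
  takes care of the first \<open>n\<close> of them.

  Since letters are arbitrary natural numbers, the matrices form an infinite family, one parabolic
  for each letter, with fixed directions far enough apart for ping-pong.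

  Canonicity is a matter of kernels alone: domination of quotients is inclusion of kernels, so the
  maximal limit quotients are given by the minimal limit kernels.\<close>

definition unital_subring :: "'a::comm_ring_1 set \<Rightarrow> bool" where
  "unital_subring A \<longleftrightarrow> 1 \<in> A \<and> (\<forall>x\<in>A. \<forall>y\<in>A. x - y \<in> A \<and> x * y \<in> A)"

lemma unital_subringD:
  assumes "unital_subring A"
  shows "1 \<in> A" "0 \<in> A" "\<And>x y. x \<in> A \<Longrightarrow> y \<in> A \<Longrightarrow> x - y \<in> A"
    "\<And>x y. x \<in> A \<Longrightarrow> y \<in> A \<Longrightarrow> x * y \<in> A"
    "\<And>x. x \<in> A \<Longrightarrow> - x \<in> A" "\<And>x y. x \<in> A \<Longrightarrow> y \<in> A \<Longrightarrow> x + y \<in> A"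
proof -
  have d: "x - y \<in> A" and p: "x * y \<in> A" if "x \<in> A" "y \<in> A" for x y
    using assms that by (auto simp: unital_subring_def)
  show 1: "1 \<in> A" using assms by (simp add: unital_subring_def)
  show 0: "0 \<in> A" using d[OF 1 1] by simp
  have m: "- x \<in> A" if "x \<in> A" for x using d[OF 0 that] by simp
  show "x - y \<in> A" "x * y \<in> A" if "x \<in> A" "y \<in> A" for x y using d p that by auto
  show "- x \<in> A" if "x \<in> A" for x using m that .
  show "x + y \<in> A" if "x \<in> A" "y \<in> A" for x y using d[of x "- y"] m that by simp
qed

inductive_set ideal_span :: "'a::comm_ring_1 set \<Rightarrow> 'a set \<Rightarrow> 'a set" for A B where
  zero: "0 \<in> ideal_span A B"
| step: "x \<in> ideal_span A B \<Longrightarrow> a \<in> A \<Longrightarrow> b \<in> B \<Longrightarrow> x + a * b \<in> ideal_span A B"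

definition ideal_in :: "'a::comm_ring_1 set \<Rightarrow> 'a set \<Rightarrow> bool" where
  "ideal_in A I \<longleftrightarrow> I \<subseteq> A \<and> 0 \<in> I \<and> (\<forall>x\<in>I. \<forall>y\<in>I. x + y \<in> I) \<and> (\<forall>a\<in>A. \<forall>x\<in>I. a * x \<in> I)"

definition noetherian_subring :: "'a::comm_ring_1 set \<Rightarrow> bool" where
  "noetherian_subring A \<longleftrightarrow> unital_subring A \<and>
     (\<forall>I. ideal_in A I \<longrightarrow> (\<exists>F. finite F \<and> F \<subseteq> I \<and> I \<subseteq> ideal_span A F))"

lemma ideal_span_add:
  assumes "x \<in> ideal_span A B" "y \<in> ideal_span A B"
  shows "x + y \<in> ideal_span A B"
  using assms(2,1) by induction (auto simp: add.assoc[symmetric] intro: ideal_span.step)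

lemma ideal_span_mult:
  assumes "unital_subring A" "c \<in> A" "x \<in> ideal_span A B"
  shows "c * x \<in> ideal_span A B"
  using assms(3)
proof induction
  case (step x a b)
  then have "c * x + (c * a) * b \<in> ideal_span A B"
    using assms by (intro ideal_span.step) (auto intro: unital_subringD)
  then show ?case by (simp add: algebra_simps)
qed (simp add: ideal_span.zero)

lemma ideal_span_incl:
  assumes "unital_subring A" "b \<in> B"
  shows "b \<in> ideal_span A B"
  using ideal_span.step[OF ideal_span.zero, of 1 A b B] assms by (simp add: unital_subringD)

lemma ideal_span_mono: "B \<subseteq> C \<Longrightarrow> A \<subseteq> A' \<Longrightarrow> ideal_span A B \<subseteq> ideal_span A' C"
proof
  fix x assume "B \<subseteq> C" "A \<subseteq> A'" "x \<in> ideal_span A B"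
  from this(3,1,2) show "x \<in> ideal_span A' C" by induction (auto intro: ideal_span.intros)
qed

lemma ideal_span_subset_ideal: "ideal_in A I \<Longrightarrow> B \<subseteq> I \<Longrightarrow> ideal_span A B \<subseteq> I"
proof
  fix x assume "ideal_in A I" "B \<subseteq> I" "x \<in> ideal_span A B"
  from this(3,1,2) show "x \<in> I" by induction (auto simp: ideal_in_def)
qed

lemma ideal_in_ideal_span:
  assumes "unital_subring A" "B \<subseteq> A"
  shows "ideal_in A (ideal_span A B)"
proof -
  have "x \<in> A" if "x \<in> ideal_span A B" for x
    using that by induction (use assms in \<open>auto intro: unital_subringD\<close>)
  then show ?thesis
    using assms by (auto simp: ideal_in_def intro: ideal_span_add ideal_span_mult ideal_span.zero)
qed

lemma ideal_span_finite_support: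
  assumes "x \<in> ideal_span A B"
  shows "\<exists>F. finite F \<and> F \<subseteq> B \<and> x \<in> ideal_span A F"
  using assms
proof induction
  case zero
  then show ?case by (auto intro: ideal_span.zero)
next
  case (step x a b)
  then obtain F where "finite F" "F \<subseteq> B" "x \<in> ideal_span A F" by blast
  moreover from this have "x \<in> ideal_span A (insert b F)"
    using ideal_span_mono[of F "insert b F" A A] by blast
  ultimately have "finite (insert b F) \<and> insert b F \<subseteq> B \<and> x + a * b \<in> ideal_span A (insert b F)"
    using step.hyps by (simp add: ideal_span.step)
  then show ?case ..
qed

lemma ideal_span_idem:
  assumes "unital_subring A" "B \<subseteq> A" "F \<subseteq> ideal_span A B"
  shows "ideal_span A F \<subseteq> ideal_span A B"
  using ideal_span_subset_ideal[OF ideal_in_ideal_span[OF assms(1,2)] assms(3)] .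

text \<open>A finite basis of the ideal spanned by \<open>B\<close> need not lie in
  \<open>B\<close>, but each of its members involves finitely many elements of \<open>B\<close>.
  Collecting these gives a basis inside \<open>B\<close>; this is what later extracts a finite
  subsystem from a system of equations.\<close>

lemma noetherian_subring_finite_subset:
  assumes "noetherian_subring A" "B \<subseteq> A"
  shows "\<exists>F. finite F \<and> F \<subseteq> B \<and> B \<subseteq> ideal_span A F"
proof -
  have A: "unital_subring A" using assms by (simp add: noetherian_subring_def)
  obtain E where E: "finite E" "E \<subseteq> ideal_span A B" "ideal_span A B \<subseteq> ideal_span A E"
    using assms ideal_in_ideal_span[OF A assms(2)] unfolding noetherian_subring_def by blast
  have "\<exists>F. finite F \<and> F \<subseteq> B \<and> E \<subseteq> ideal_span A F"
    using E(1,2)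
  proof (induction E)
    case (insert e E)
    then obtain F where F: "finite F" "F \<subseteq> B" "E \<subseteq> ideal_span A F" by auto
    obtain F' where F': "finite F'" "F' \<subseteq> B" "e \<in> ideal_span A F'"
      using ideal_span_finite_support[of e A B] insert.prems by blast
    have "finite (F \<union> F') \<and> F \<union> F' \<subseteq> B \<and> insert e E \<subseteq> ideal_span A (F \<union> F')"
      using F F' ideal_span_mono[of F "F \<union> F'" A A] ideal_span_mono[of F' "F \<union> F'" A A] by blast
    then show ?case ..
  qed auto
  then obtain F where F: "finite F" "F \<subseteq> B" "E \<subseteq> ideal_span A F" by blast
  have "ideal_span A E \<subseteq> ideal_span A F" by (rule ideal_span_idem) (use A F assms in auto)
  then have "B \<subseteq> ideal_span A F" using E(3) ideal_span_incl[OF A, of _ B] by blast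
  with F show ?thesis by blast
qed

section \<open>Adjoining one element to a subring, and Hilbert's basis theorem\<close>

primrec polys_below :: "'a::comm_ring_1 set \<Rightarrow> 'a \<Rightarrow> nat \<Rightarrow> 'a set" where
  "polys_below A f 0 = {0}"
| "polys_below A f (Suc n) = {m + a * f ^ n | m a. m \<in> polys_below A f n \<and> a \<in> A}"

text \<open>This is the ring \<open>A[f]\<close>, filtered by degree:
  \<open>polys_below A f n\<close> consists of the values at \<open>f\<close> of the polynomials
  over \<open>A\<close> of degree less than \<open>n\<close>.\<close>

definition adjoin :: "'a::comm_ring_1 set \<Rightarrow> 'a \<Rightarrow> 'a set" where
  "adjoin A f = (\<Union>n. polys_below A f n)"

context
  fixes A :: "'a::comm_ring_1 set" and f :: 'a
  assumes A: "unital_subring A"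
begin

lemma polys_below_0: "0 \<in> polys_below A f n"
proof (induction n)
  case (Suc n)
  then have "0 + 0 * f ^ n \<in> polys_below A f (Suc n)"
    using unital_subringD(2)[OF A] by (simp del: mult_zero_left add_0_left) blast
  then show ?case by simp
qed simp

lemma polys_below_add:
  "x \<in> polys_below A f n \<Longrightarrow> y \<in> polys_below A f n \<Longrightarrow> x + y \<in> polys_below A f n"
proof (induction n arbitrary: x y)
  case (Suc n)
  then obtain m a m' a' where *: "x = m + a * f ^ n" "m \<in> polys_below A f n" "a \<in> A"
    "y = m' + a' * f ^ n" "m' \<in> polys_below A f n" "a' \<in> A" by auto
  then have "x + y = (m + m') + (a + a') * f ^ n" by (simp add: algebra_simps)
  then show ?case
    unfolding polys_below.simps using Suc.IH[of m m'] unital_subringD(6)[OF A, of a a'] * by blast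
qed simp

lemma polys_below_scale:
  "c \<in> A \<Longrightarrow> x \<in> polys_below A f n \<Longrightarrow> c * x \<in> polys_below A f n"
proof (induction n arbitrary: x)
  case (Suc n)
  then obtain m a where x: "x = m + a * f ^ n" "m \<in> polys_below A f n" "a \<in> A" by auto
  then have "c * x = c * m + (c * a) * f ^ n" by (simp add: algebra_simps)
  then show ?case using Suc.IH[OF Suc.prems(1) x(2)] Suc.prems(1) x(3) unital_subringD(4)[OF A] by auto
qed simp

lemma polys_below_minus: "x \<in> polys_below A f n \<Longrightarrow> - x \<in> polys_below A f n"
  using polys_below_scale[of "-1" x n] unital_subringD[OF A] by simp

lemma polys_below_Suc: "x \<in> polys_below A f n \<Longrightarrow> x \<in> polys_below A f (Suc n)"
proof -
  assume "x \<in> polys_below A f n"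
  then have "x + 0 * f ^ n \<in> polys_below A f (Suc n)"
    unfolding polys_below.simps using unital_subringD(2)[OF A] by blast
  then show ?thesis by simp
qed

lemma polys_below_mono: "n \<le> n' \<Longrightarrow> polys_below A f n \<subseteq> polys_below A f n'"
  by (rule lift_Suc_mono_le) (use polys_below_Suc in blast)+

lemma polys_below_shift: "x \<in> polys_below A f n \<Longrightarrow> f * x \<in> polys_below A f (Suc n)"
proof (induction n arbitrary: x)
  case 0
  then show ?case using polys_below_0[of 1] by simp
next
  case (Suc n)
  then obtain m a where x: "x = m + a * f ^ n" "m \<in> polys_below A f n" "a \<in> A" by auto
  then have "f * x = f * m + a * f ^ Suc n" by (simp add: algebra_simps)
  then show ?case using x Suc.IH[of m] polys_below.simps(2)[of A f "Suc n"] by blast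
qed

lemma polys_below_shift_power: "x \<in> polys_below A f n \<Longrightarrow> f ^ i * x \<in> polys_below A f (i + n)"
  by (induction i) (auto simp: mult.assoc simp del: polys_below.simps intro: polys_below_shift)

lemma polys_below_coeff: "a \<in> A \<Longrightarrow> a * f ^ n \<in> polys_below A f (Suc n)"
  using polys_below_0[of n] by force

lemma subset_adjoin: "A \<subseteq> adjoin A f"
proof
  fix a assume "a \<in> A"
  then have "a \<in> polys_below A f (Suc 0)" using polys_below_coeff[of a 0] by simp
  then show "a \<in> adjoin A f" unfolding adjoin_def by blast
qed

lemma mem_adjoin: "f \<in> adjoin A f"
proof -
  have "f \<in> polys_below A f (Suc 1)"
    using polys_below_coeff[of 1 1] unital_subringD(1)[OF A] by (simp del: polys_below.simps)
  then show ?thesis unfolding adjoin_def by blast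
qed

lemma adjoin_add:
  assumes "x \<in> adjoin A f" "y \<in> adjoin A f"
  shows "x + y \<in> adjoin A f"
proof -
  obtain n n' where "x \<in> polys_below A f n" "y \<in> polys_below A f n'"
    using assms by (auto simp: adjoin_def)
  then have "x \<in> polys_below A f (max n n')" "y \<in> polys_below A f (max n n')"
    using polys_below_mono[of n "max n n'"] polys_below_mono[of n' "max n n'"] by auto
  then show ?thesis using polys_below_add unfolding adjoin_def by blast
qed

lemma adjoin_mult:
  assumes "x \<in> adjoin A f" "y \<in> adjoin A f"
  shows "x * y \<in> adjoin A f"
proof -
  obtain n where "y \<in> polys_below A f n" using assms by (auto simp: adjoin_def)
  then show ?thesis
  proof (induction n arbitrary: y)
    case 0
    then have "x * y \<in> polys_below A f 0" by simp
    then show ?case unfolding adjoin_def by blast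
  next
    case (Suc n)
    then obtain m a where y: "y = m + a * f ^ n" "m \<in> polys_below A f n" "a \<in> A" by auto
    obtain j where "x \<in> polys_below A f j" using assms by (auto simp: adjoin_def)
    then have "a * (f ^ n * x) \<in> polys_below A f (n + j)"
      using y polys_below_shift_power polys_below_scale by blast
    then have "x * m + a * (f ^ n * x) \<in> adjoin A f"
      using Suc.IH[OF y(2)] adjoin_add unfolding adjoin_def by blast
    then show ?case using y by (simp add: algebra_simps)
  qed
qed

lemma unital_subring_adjoin: "unital_subring (adjoin A f)"
proof -
  have "x - y \<in> adjoin A f" if "x \<in> adjoin A f" "y \<in> adjoin A f" for x y
    using adjoin_add[of x "- y"] that polys_below_minus unfolding adjoin_def by (metis UN_iff diff_conv_add_uminus)
  then show ?thesis
    using subset_adjoin unital_subringD(1)[OF A] adjoin_mult by (auto simp: unital_subring_def)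
qed

text \<open>Hilbert's basis theorem, with the ideals of leading coefficients of elements of degree at
  most \<open>n\<close>; no polynomial ring is needed since representations need not be unique.\<close>

lemma noetherian_adjoin:
  assumes noeth: "noetherian_subring A"
  shows "noetherian_subring (adjoin A f)"
  unfolding noetherian_subring_def
proof (intro conjI unital_subring_adjoin allI impI)
  note AD = unital_subringD[OF A]
  fix I assume I: "ideal_in (adjoin A f) I"
  have I0: "0 \<in> I" and Iadd: "\<And>x y. x \<in> I \<Longrightarrow> y \<in> I \<Longrightarrow> x + y \<in> I"
    and Imul: "\<And>a x. a \<in> adjoin A f \<Longrightarrow> x \<in> I \<Longrightarrow> a * x \<in> I" and IA: "I \<subseteq> adjoin A f"
    using I by (auto simp: ideal_in_def)
  define J where "J n = {a \<in> A. \<exists>p\<in>I. p - a * f ^ n \<in> polys_below A f n}" for n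
  have JI: "a \<in> J n" if "a \<in> A" "p \<in> I" "p - a * f ^ n \<in> polys_below A f n" for a p n
    unfolding J_def using that by blast
  have J_mono1: "J n \<subseteq> J (Suc n)" for n
  proof
    fix a assume "a \<in> J n"
    then obtain p where p: "a \<in> A" "p \<in> I" "p - a * f ^ n \<in> polys_below A f n" by (auto simp: J_def)
    have "f * p - a * f ^ Suc n = f * (p - a * f ^ n)" by (simp add: algebra_simps)
    then have "f * p - a * f ^ Suc n \<in> polys_below A f (Suc n)"
      using polys_below_shift[OF p(3)] by (simp only:)
    then show "a \<in> J (Suc n)" using p by (intro JI[of _ "f * p"] Imul mem_adjoin)
  qed
  have J_mono: "J n \<subseteq> J n'" if "n \<le> n'" for n n'
    using lift_Suc_mono_le[of J, OF J_mono1 that] .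
  have J_add: "a + b \<in> J n" if ab: "a \<in> J n" "b \<in> J n" for a b n
  proof -
    obtain p q where pq: "a \<in> A" "p \<in> I" "p - a * f ^ n \<in> polys_below A f n"
      "b \<in> A" "q \<in> I" "q - b * f ^ n \<in> polys_below A f n" using ab unfolding J_def by blast
    have "(p + q) - (a + b) * f ^ n = (p - a * f ^ n) + (q - b * f ^ n)" by (simp add: algebra_simps)
    then have "(p + q) - (a + b) * f ^ n \<in> polys_below A f n"
      using polys_below_add pq by (simp only:)
    then show ?thesis using pq by (intro JI[of _ "p + q"] Iadd AD)
  qed
  have J_mul: "c * a \<in> J n" if ac: "a \<in> J n" "c \<in> A" for a c n
  proof -
    obtain p where pq: "a \<in> A" "p \<in> I" "p - a * f ^ n \<in> polys_below A f n"
      using ac(1) unfolding J_def by blast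
    have "c * p - (c * a) * f ^ n = c * (p - a * f ^ n)" by (simp add: algebra_simps)
    then have "c * p - (c * a) * f ^ n \<in> polys_below A f n"
      using polys_below_scale pq ac by (simp only:)
    moreover have "c \<in> adjoin A f" using ac(2) subset_adjoin by (rule set_mp[rotated])
    ultimately show ?thesis using pq ac by (intro JI[of _ "c * p"] Imul AD)
  qed
  have J_ideal: "ideal_in A (J n)" for n
    unfolding ideal_in_def
  proof (intro conjI ballI)
    show "J n \<subseteq> A" by (auto simp: J_def)
    show "0 \<in> J n" using JI[OF AD(2) I0, of n] polys_below_0[of n] by simp
  qed (use J_add J_mul in auto)
  have "ideal_in A (\<Union>n. J n)"
    unfolding ideal_in_def
  proof (intro conjI ballI)
    have "J n \<subseteq> A \<and> 0 \<in> J n" for n using J_ideal[of n] by (simp add: ideal_in_def)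
    then show "(\<Union>n. J n) \<subseteq> A" "0 \<in> (\<Union>n. J n)" by blast+
    fix x y assume "x \<in> (\<Union>n. J n)" "y \<in> (\<Union>n. J n)"
    then obtain i j where "x \<in> J i" "y \<in> J j" by blast
    then have "x \<in> J (max i j)" "y \<in> J (max i j)"
      using J_mono[of i "max i j"] J_mono[of j "max i j"] by auto
    then show "x + y \<in> (\<Union>n. J n)" using J_add by blast
  next
    fix a x assume "a \<in> A" "x \<in> (\<Union>n. J n)"
    then show "a * x \<in> (\<Union>n. J n)" using J_mul by blast
  qed
  then obtain F where F: "finite F" "F \<subseteq> (\<Union>n. J n)" "(\<Union>n. J n) \<subseteq> ideal_span A F"
    using noeth by (auto simp: noetherian_subring_def)
  \<comment> \<open>The ideals \<open>J n\<close> increase, so the finitely many generators of their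
    union lie in a single one, and the chain is constant from there on.\<close>
  have "\<exists>N. F \<subseteq> J N"
    using F(1,2)
  proof (induction F)
    case (insert x F)
    then obtain N i where "F \<subseteq> J N" "x \<in> J i" by auto
    then have "insert x F \<subseteq> J (max i N)"
      using J_mono[of i "max i N"] J_mono[of N "max i N"] by auto
    then show ?case ..
  qed auto
  then obtain N where N: "F \<subseteq> J N" ..
  have JN: "J n \<subseteq> J N" for n
    using F(3) ideal_span_subset_ideal[OF J_ideal N] by blast
  have "\<forall>n. \<exists>E. finite E \<and> E \<subseteq> J n \<and> J n \<subseteq> ideal_span A E"
    using noeth J_ideal unfolding noetherian_subring_def by blast
  then obtain E where E: "\<And>n. finite (E n)" "\<And>n. E n \<subseteq> J n" "\<And>n. J n \<subseteq> ideal_span A (E n)"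
    by metis
  have "\<forall>n. \<forall>a\<in>J n. \<exists>p\<in>I. p - a * f ^ n \<in> polys_below A f n" by (auto simp: J_def)
  then obtain w where w: "\<And>n a. a \<in> J n \<Longrightarrow> w n a \<in> I"
    "\<And>n a. a \<in> J n \<Longrightarrow> w n a - a * f ^ n \<in> polys_below A f n" by metis
  \<comment> \<open>One element of \<open>I\<close> for each generator of a leading coefficient
    ideal in degree at most \<open>N\<close>. Higher degrees are reached by multiplying with powers
    of \<open>f\<close>.\<close>
  define B where "B = (\<Union>n\<le>N. w n ` E n)"
  have EJ: "b \<in> J n" if "b \<in> E n" for b n using E(2)[of n] that by blast
  have B: "finite B" "B \<subseteq> I" using E(1) w(1)[OF EJ] by (auto simp: B_def)
  let ?S = "ideal_span (adjoin A f) B"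
  have lift: "\<exists>p\<in>?S. p - a * f ^ n \<in> polys_below A f n" if "a \<in> ideal_span A (E n)" "n \<le> N" for a n
    using that(1)
  proof induction
    case zero
    then show ?case using ideal_span.zero polys_below_0 by (intro bexI[of _ 0]) auto
  next
    case (step x c b)
    then obtain p where p: "p \<in> ?S" "p - x * f ^ n \<in> polys_below A f n" by blast
    have "(p + c * w n b) - (x + c * b) * f ^ n = (p - x * f ^ n) + c * (w n b - b * f ^ n)"
      by (simp add: algebra_simps)
    moreover have "\<dots> \<in> polys_below A f n"
      using p step.hyps w(2)[OF EJ] by (intro polys_below_add polys_below_scale)
    moreover have "p + c * w n b \<in> ?S"
      using p step.hyps \<open>n \<le> N\<close> subset_adjoin by (intro ideal_span.step) (auto simp: B_def)
    ultimately show ?case by (intro bexI[of _ "p + c * w n b"]) (simp_all only:)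
  qed
  have SI: "?S \<subseteq> I" using ideal_span_subset_ideal[OF I B(2)] .
  have "x \<in> ?S" if "x \<in> I" "x \<in> polys_below A f n" for x n
    using that
  proof (induction n arbitrary: x)
    case 0
    then show ?case by (simp add: ideal_span.zero)
  next
    case (Suc n)
    then obtain m a where x: "x = m + a * f ^ n" "m \<in> polys_below A f n" "a \<in> A" by auto
    from x have "x - a * f ^ n \<in> polys_below A f n" by simp
    with x Suc.prems have a: "a \<in> J n" by (intro JI[of a x n])
    \<comment> \<open>Above degree \<open>N\<close> the leading coefficient already occurs in degree
      \<open>N\<close>. An element of the span with this coefficient in degree \<open>n'\<close> is
      shifted up by \<open>f ^ (n - n')\<close> and subtracted from \<open>x\<close>, which removes
      the top term.\<close>
    define n' where "n' = min n N"
    have "a \<in> J n'" using a JN[of n] by (auto simp: n'_def min_def)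
    then obtain p where p: "p \<in> ?S" "p - a * f ^ n' \<in> polys_below A f n'"
      using lift[of a n'] E(3)[of n'] by (auto simp: n'_def)
    have n: "n = (n - n') + n'" by (simp add: n'_def)
    define q where "q = f ^ (n - n') * p"
    have "f ^ (n - n') \<in> polys_below A f (Suc (n - n'))"
      using polys_below_coeff[of 1 "n - n'"] AD(1) by (simp del: polys_below.simps)
    then have "f ^ (n - n') \<in> adjoin A f" unfolding adjoin_def by blast
    then have q: "q \<in> ?S" unfolding q_def using p ideal_span_mult[OF unital_subring_adjoin] by blast
    have "q - a * f ^ n = f ^ (n - n') * (p - a * f ^ n')"
      unfolding q_def by (subst (2) n, simp only: power_add) (simp add: algebra_simps)
    then have 1: "q - a * f ^ n \<in> polys_below A f n"
      using polys_below_shift_power[OF p(2), of "n - n'"] n by simp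
    have "x - q = m + - (q - a * f ^ n)" using x by simp
    then have 2: "x - q \<in> polys_below A f n"
      using polys_below_add[OF x(2) polys_below_minus[OF 1]] by (simp only:)
    have "- 1 * q \<in> ?S" using q unital_subring_adjoin by (intro ideal_span_mult) (auto intro: unital_subringD)
    then have "x + - 1 * q \<in> I" using SI Suc.prems(1) by (intro Iadd) blast+
    then have "x - q \<in> ?S" using Suc.IH[of "x - q"] 2 by simp
    then show ?case using ideal_span_add[OF _ q, of "x - q"] by simp
  qed
  then have "I \<subseteq> ?S" using IA unfolding adjoin_def by blast
  with B show "\<exists>F. finite F \<and> F \<subseteq> I \<and> I \<subseteq> ideal_span (adjoin A f) F" by blast
qed

end

lemma noetherian_extend_finite:
  assumes "finite F" "noetherian_subring A"
  shows "\<exists>A'. noetherian_subring A' \<and> A \<subseteq> A' \<and> F \<subseteq> A'"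
  using assms(1)
proof induction
  case empty
  then show ?case using assms by blast
next
  case (insert f F)
  then obtain A' where A': "noetherian_subring A'" "A \<subseteq> A'" "F \<subseteq> A'" by blast
  then have "unital_subring A'" by (simp add: noetherian_subring_def)
  from noetherian_adjoin[OF this A'(1)] subset_adjoin[OF this] mem_adjoin[OF this] show ?case
    using A' by blast
qed

text \<open>The constant functions are a copy of the field of reals, so any nonzero element
  generates a nonzero ideal. This ring is the base to which matrix entries are adjoined.\<close>

lemma noetherian_constants: "noetherian_subring (range (\<lambda>c (_ :: 'h). c :: real))"
  unfolding noetherian_subring_def
proof (intro conjI allI impI)
  let ?A = "range (\<lambda>c (_ :: 'h). c :: real)"
  show A: "unital_subring ?A"
  proof -
    have "(1 :: 'h \<Rightarrow> real) = (\<lambda>_. 1)"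
      and "(\<lambda>_. c) - (\<lambda>_. d) = (\<lambda>_ :: 'h. c - d)" and "(\<lambda>_. c) * (\<lambda>_. d) = (\<lambda>_ :: 'h. c * d)"
      for c d :: real by (auto simp: fun_eq_iff)
    then show ?thesis unfolding unital_subring_def by auto
  qed
  fix I assume I: "ideal_in ?A I"
  show "\<exists>F. finite F \<and> F \<subseteq> I \<and> I \<subseteq> ideal_span ?A F"
  proof (cases "I \<subseteq> {0}")
    case True
    then show ?thesis using ideal_span.zero by (intro exI[of _ "{}"]) auto
  next
    case False
    then obtain x where x: "x \<in> I" "x \<noteq> 0" by blast
    moreover from this obtain c where c: "x = (\<lambda>_. c)" using I unfolding ideal_in_def by blast
    ultimately have "c \<noteq> 0" by (auto simp: fun_eq_iff)
    have "y \<in> ideal_span ?A {x}" if y: "y \<in> I" for y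
    proof -
      obtain d where "y = (\<lambda>_. d)" using y I unfolding ideal_in_def by blast
      then have "y = (\<lambda>_. d / c) * x" using c \<open>c \<noteq> 0\<close> by (intro ext) simp
      then show ?thesis using ideal_span_mult[OF A, of "\<lambda>_. d / c" x "{x}"] ideal_span_incl[OF A, of x "{x}"] by blast
    qed
    then show ?thesis using x by (intro exI[of _ "{x}"]) auto
  qed
qed

section \<open>A faithful action of the free groups by matrices\<close>

text \<open>The letter \<open>(b, i)\<close> acts by the parabolic matrix fixing the direction \<open>3 i\<close>; in the coordinate
  \<open>w = q / (p - 3 i q)\<close> on the projective line this is \<open>w \<mapsto> w \<plusminus> 2\<close>.\<close>

fun letter_act :: "bool \<times> nat \<Rightarrow> real \<times> real \<Rightarrow> real \<times> real" where
  "letter_act (b, i) (p, q) =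
     (let u = p - 3 * real i * q; q' = q + (if b then 2 else - 2) * u in (u + 3 * real i * q', q'))"

definition word_act :: "nat gword \<Rightarrow> real \<times> real \<Rightarrow> real \<times> real" where
  "word_act w = foldr letter_act w"

lemma word_act_simps [simp]:
  "word_act [] v = v" "word_act (l # w) v = letter_act l (word_act w v)"
  "word_act (u @ w) v = word_act u (word_act w v)"
  by (simp_all add: word_act_def)

lemma letter_act_inverse: "letter_act (b, i) (letter_act (\<not> b, i) v) = v"
  by (cases v) (auto simp: Let_def algebra_simps)

lemma letter_act_linear:
  "letter_act l (p * a + q * c, p * b + q * d) =
    (p * fst (letter_act l (a, b)) + q * fst (letter_act l (c, d)),
     p * snd (letter_act l (a, b)) + q * snd (letter_act l (c, d)))"
  by (cases l) (simp add: Let_def algebra_simps)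

text \<open>The images of \<open>(1, 0)\<close> and \<open>(0, 1)\<close> are the columns of the
  matrix of \<open>w\<close>; in this form the entries of a product become polynomials in the
  entries of the factors.\<close>

lemma word_act_linear:
  "word_act w (p, q) =
    (p * fst (word_act w (1, 0)) + q * fst (word_act w (0, 1)),
     p * snd (word_act w (1, 0)) + q * snd (word_act w (0, 1)))"
proof (induction w)
  case (Cons l w)
  show ?case
    unfolding word_act_simps Cons.IH
    by (subst letter_act_linear) (simp only: prod.collapse)
qed simp

lemma group_cong_word_act:
  "(u, v) \<in> group_cong X {} \<Longrightarrow> word_act u = word_act v"
proof (induction rule: group_cong.induct)
  case (mult u v u' v')
  then show ?case by (simp only: fun_eq_iff word_act_simps) simp
qed (auto simp: fun_eq_iff letter_act_inverse)

section \<open>Reduced words and ping-pong\<close>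

fun reduced :: "(bool \<times> 'x) list \<Rightarrow> bool" where
  "reduced (l # l' # w) \<longleftrightarrow> \<not> (fst l \<noteq> fst l' \<and> snd l = snd l') \<and> reduced (l' # w)"
| "reduced _ = True"

text \<open>Prepending a letter to a reduced word either leaves it reduced or cancels against its
  head.\<close>

lemma reduced_representative:
  "w \<in> lists (UNIV \<times> X) \<Longrightarrow> \<exists>w'. reduced w' \<and> (w, w') \<in> group_cong X {} \<and> w' \<in> lists (UNIV \<times> X)"
proof (induction w)
  case Nil
  then show ?case by (auto intro: group_cong.refl exI[of _ "[]"])
next
  case (Cons l w)
  then obtain w' where w': "reduced w'" "(w, w') \<in> group_cong X {}" "w' \<in> lists (UNIV \<times> X)" by auto
  have l: "([l], [l]) \<in> group_cong X {}" using Cons by (auto intro: group_cong.refl)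
  have c: "(l # w, l # w') \<in> group_cong X {}" using group_cong.mult[OF l w'(2)] by simp
  show ?case
  proof (cases "\<exists>w''. w' = (\<not> fst l, snd l) # w''")
    case True
    then obtain w'' where e: "w' = (\<not> fst l, snd l) # w''" ..
    then have w'': "w'' \<in> lists (UNIV \<times> X)" "reduced w''" using w' by (auto elim: reduced.elims)
    have "([l, (\<not> fst l, snd l)], []) \<in> group_cong X {}"
      using group_cong.cancel[of "snd l" X "fst l"] Cons by (cases l) auto
    from group_cong.mult[OF this group_cong.refl[of w'' X]] w''
    have "(l # w', w'') \<in> group_cong X {}" by (simp add: e)
    then show ?thesis using c w'' group_cong.trans by blast
  next
    case False
    have "reduced (l # w')"
    proof (cases w')
      case (Cons l' v)
      then have "l' \<noteq> (\<not> fst l, snd l)" using False by blast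
      then have "\<not> (fst l \<noteq> fst l' \<and> snd l = snd l')" by (auto simp: prod_eq_iff)
      then show ?thesis using w'(1) Cons by simp
    qed simp
    then show ?thesis using c w' Cons by (intro exI[of _ "l # w'"]) auto
  qed
qed

text \<open>In the coordinate \<open>w\<close> of the letter these are the rays \<open>w > 1\<close>
  and \<open>w < - 1\<close>. Apart from \<open>w\<close> infinite, \<open>\<bar>w\<bar> > 1\<close>
  means that the slope \<open>p / q\<close> is within 1 of \<open>3 * i\<close>; the spacing 3 keeps
  these neighbourhoods disjoint for different \<open>i\<close>.\<close>

fun ping_pong_set :: "bool \<times> nat \<Rightarrow> (real \<times> real) set" where
  "ping_pong_set (b, i) =
     {(p, q). p - 3 * real i * q \<noteq> 0 \<and>
        (if b then q / (p - 3 * real i * q) > 1 else q / (p - 3 * real i * q) < - 1)}"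

declare ping_pong_set.simps [simp del]

text \<open>The shift by 2 carries \<open>w > - 1\<close> into \<open>w > 1\<close>, and the shift
  by \<open>- 2\<close> carries \<open>w < 1\<close> into \<open>w < - 1\<close>. The start vector
  has \<open>w = 0\<close>, a vector in the set of a letter with another index has
  \<open>\<bar>w\<bar> < 1\<close>, and one in the set of the same letter is already on the right
  side. Only the set of the inverse letter is excluded.\<close>

lemma ping_pong:
  assumes "v = (1, 0) \<or> (\<exists>l'. v \<in> ping_pong_set l' \<and> \<not> (fst l \<noteq> fst l' \<and> snd l = snd l'))"
  shows "letter_act l v \<in> ping_pong_set l"
proof -
  obtain b i where l: "l = (b, i)" by (cases l)
  obtain p q where v: "v = (p, q)" by (cases v)
  define u where "u = p - 3 * real i * q"
  have "u \<noteq> 0 \<and> (if b then q / u > - 1 else q / u < 1)"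
    using assms
  proof (elim disjE exE conjE)
    assume "v = (1, 0)"
    then show ?thesis by (auto simp: u_def v)
  next
    fix l' assume l': "v \<in> ping_pong_set l'" "\<not> (fst l \<noteq> fst l' \<and> snd l = snd l')"
    obtain c j where c: "l' = (c, j)" by (cases l')
    define t where "t = p - 3 * real j * q"
    have t: "t \<noteq> 0" "if c then q / t > 1 else q / t < - 1"
      using l' by (auto simp: ping_pong_set.simps c v t_def split: if_splits)
    show ?thesis
    proof (cases "i = j")
      case True
      then show ?thesis using t l' by (auto simp: c l t_def u_def split: if_splits)
    next
      case False
      \<comment> \<open>The slope \<open>p / q\<close> is within 1 of \<open>3 * j\<close>, hence
        more than 1 away from \<open>3 * i\<close>, so the coordinate belonging to \<open>i\<close>
        has absolute value below 1.\<close>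
      have "\<bar>q / t\<bar> > 1" using t(2) by (simp del: abs_divide split: if_splits)
      then have tq: "\<bar>t\<bar> < \<bar>q\<bar>" using t(1) by (simp add: abs_divide less_divide_eq)
      have "\<bar>real j - real i\<bar> \<ge> 1" using False by linarith
      then have "\<bar>3 * (real j - real i) * q\<bar> \<ge> 3 * \<bar>q\<bar>"
        by (simp add: abs_mult mult_right_mono mult_le_cancel_right1)
      moreover have "u = t + 3 * (real j - real i) * q" by (simp add: u_def t_def algebra_simps)
      ultimately have "\<bar>u\<bar> > \<bar>q\<bar>" using tq by linarith
      then have "u \<noteq> 0" "\<bar>q / u\<bar> < 1" by (auto simp: abs_divide divide_less_eq)
      then show ?thesis by (auto simp del: abs_divide)
    qed
  qed
  then show ?thesis
    by (auto simp: ping_pong_set.simps l v Let_def u_def[symmetric] add_divide_distrib diff_divide_distrib)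
qed

lemma reduced_ping_pong:
  "reduced (l # w) \<Longrightarrow> word_act (l # w) (1, 0) \<in> ping_pong_set l"
proof (induction w arbitrary: l)
  case Nil
  then show ?case using ping_pong[of "(1,0)" l] by simp
next
  case (Cons l' w)
  then have "word_act (l' # w) (1, 0) \<in> ping_pong_set l'" "\<not> (fst l \<noteq> fst l' \<and> snd l = snd l')"
    by auto
  then have "letter_act l (word_act (l' # w) (1, 0)) \<in> ping_pong_set l" by (intro ping_pong) blast
  then show ?case by simp
qed

text \<open>A nonempty reduced word moves \<open>(1, 0)\<close> into a ping-pong set, and none of
  these contains \<open>(1, 0)\<close>. Triviality of a group element is thus tested on one vector,
  that is, by the two entries of the first column.\<close>

lemma word_act_eq_imp_trivial:
  assumes "w \<in> lists (UNIV \<times> X)" "word_act w (1, 0) = (1, 0)"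
  shows "(w, []) \<in> group_cong X {}"
proof -
  obtain w' where w': "reduced w'" "(w, w') \<in> group_cong X {}"
    using reduced_representative[OF assms(1)] by blast
  have "word_act w' (1, 0) = (1, 0)" using group_cong_word_act[OF w'(2)] assms by simp
  moreover have "(1, 0) \<notin> ping_pong_set l" for l by (cases l) (auto simp: ping_pong_set.simps)
  ultimately have "w' = []" using reduced_ping_pong w'(1) by (metis neq_Nil_conv)
  with w' show ?thesis by simp
qed

section \<open>Presented groups\<close>

abbreviation word_class :: "'x set \<Rightarrow> ('x gword \<times> 'x gword) set \<Rightarrow> 'x gword \<Rightarrow> 'x gword set" where
  "word_class X R w \<equiv> group_cong X R `` {w}"

definition inverse_word :: "'x gword \<Rightarrow> 'x gword" where
  "inverse_word w = rev (map (\<lambda>(b, x). (\<not> b, x)) w)"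

context
  fixes X :: "'x set" and R :: "('x gword \<times> 'x gword) set"
  assumes R: "R \<subseteq> lists (UNIV \<times> X) \<times> lists (UNIV \<times> X)"
begin

lemma group_cong_in_lists:
  "(u, v) \<in> group_cong X R \<Longrightarrow> u \<in> lists (UNIV \<times> X) \<and> v \<in> lists (UNIV \<times> X)"
proof (induction rule: group_cong.induct)
  case (rel u v)
  then show ?case using R by blast
qed simp_all

lemma equiv_group_cong: "equiv (lists (UNIV \<times> X)) (group_cong X R)"
proof (rule equivI)
  show "group_cong X R \<subseteq> lists (UNIV \<times> X) \<times> lists (UNIV \<times> X)"
    using group_cong_in_lists by (intro subrelI) blast
  show "refl_on (lists (UNIV \<times> X)) (group_cong X R)"
    by (rule refl_onI) (rule group_cong.refl)
  show "sym (group_cong X R)" by (rule symI) (rule group_cong.sym)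
  show "trans (group_cong X R)" by (rule transI) (rule group_cong.trans)
qed

lemma word_class_eq_iff:
  "u \<in> lists (UNIV \<times> X) \<Longrightarrow> v \<in> lists (UNIV \<times> X) \<Longrightarrow>
    word_class X R u = word_class X R v \<longleftrightarrow> (u, v) \<in> group_cong X R"
  using eq_equiv_class_iff[OF equiv_group_cong] .

lemma word_class_in_carrier [simp]:
  "w \<in> lists (UNIV \<times> X) \<Longrightarrow> word_class X R w \<in> carrier (presented_group X R)"
  by (simp add: presented_group_def quotientI)

lemma presented_groupE:
  assumes "C \<in> carrier (presented_group X R)"
  obtains w where "w \<in> lists (UNIV \<times> X)" "C = word_class X R w"
  using assms unfolding presented_group_def by (auto elim!: quotientE)

lemma word_class_mult:
  assumes "u \<in> lists (UNIV \<times> X)" "v \<in> lists (UNIV \<times> X)"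
  shows "word_class X R u \<otimes>\<^bsub>presented_group X R\<^esub> word_class X R v = word_class X R (u @ v)"
proof -
  have "word_class X R (a @ b) = word_class X R (u @ v)"
    if "a \<in> word_class X R u" "b \<in> word_class X R v" for a b
    using that group_cong.mult[of u a X R v b] equiv_class_eq[OF equiv_group_cong] by simp
  moreover have "u \<in> word_class X R u" "v \<in> word_class X R v"
    using assms by (auto intro: group_cong.refl)
  ultimately have "(\<Union>a\<in>word_class X R u. \<Union>b\<in>word_class X R v. word_class X R (a @ b)) =
      word_class X R (u @ v)"
    by (intro UN_constant_eq ballI)
  then show ?thesis by (simp add: presented_group_def)
qed

lemma presented_group_one: "\<one>\<^bsub>presented_group X R\<^esub> = word_class X R []"
  by (simp add: presented_group_def)

lemma inverse_word_cong:
  "w \<in> lists (UNIV \<times> X) \<Longrightarrow>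
    inverse_word w \<in> lists (UNIV \<times> X) \<and> (inverse_word w @ w, []) \<in> group_cong X R"
proof (induction w)
  case Nil
  then show ?case by (auto simp: inverse_word_def intro: group_cong.refl)
next
  case (Cons l w)
  obtain b x where l: "l = (b, x)" by (cases l)
  let ?v = "inverse_word w"
  have w: "w \<in> lists (UNIV \<times> X)" "x \<in> X" using Cons.prems l by auto
  then have IH: "?v \<in> lists (UNIV \<times> X)" "(?v @ w, []) \<in> group_cong X R" using Cons.IH by auto
  have e: "inverse_word (l # w) = ?v @ [(\<not> b, x)]" by (simp add: inverse_word_def l)
  have "([(\<not> b, x), (b, x)], []) \<in> group_cong X R"
    using group_cong.cancel[of x X "\<not> b" R] w by simp
  from group_cong.mult[OF group_cong.mult[OF group_cong.refl[OF IH(1)] this] group_cong.refl[OF w(1)]]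
  have "(inverse_word (l # w) @ l # w, ?v @ w) \<in> group_cong X R"
    by (simp only: e) (simp add: l)
  then show ?case using group_cong.trans IH w by (auto simp: e)
qed

lemma group_presented_group: "group (presented_group X R)"
proof (rule groupI)
  let ?G = "presented_group X R"
  show "\<one>\<^bsub>?G\<^esub> \<in> carrier ?G" by (simp add: presented_group_one)
  fix x y z assume "x \<in> carrier ?G" "y \<in> carrier ?G" "z \<in> carrier ?G"
  then obtain u v w where "u \<in> lists (UNIV \<times> X)" "v \<in> lists (UNIV \<times> X)" "w \<in> lists (UNIV \<times> X)"
    "x = word_class X R u" "y = word_class X R v" "z = word_class X R w"
    by (metis presented_groupE)
  then show "x \<otimes>\<^bsub>?G\<^esub> y \<otimes>\<^bsub>?G\<^esub> z = x \<otimes>\<^bsub>?G\<^esub> (y \<otimes>\<^bsub>?G\<^esub> z)"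
    by (simp add: word_class_mult)
next
  let ?G = "presented_group X R"
  fix x y assume "x \<in> carrier ?G" "y \<in> carrier ?G"
  then obtain u v where "u \<in> lists (UNIV \<times> X)" "v \<in> lists (UNIV \<times> X)"
    "x = word_class X R u" "y = word_class X R v"
    by (metis presented_groupE)
  then show "x \<otimes>\<^bsub>?G\<^esub> y \<in> carrier ?G" by (simp add: word_class_mult)
next
  let ?G = "presented_group X R"
  fix x assume "x \<in> carrier ?G"
  then obtain u where u: "u \<in> lists (UNIV \<times> X)" "x = word_class X R u"
    by (metis presented_groupE)
  then show "\<one>\<^bsub>?G\<^esub> \<otimes>\<^bsub>?G\<^esub> x = x" by (simp add: word_class_mult presented_group_one)
  have "word_class X R (inverse_word u) \<otimes>\<^bsub>?G\<^esub> x = \<one>\<^bsub>?G\<^esub>"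
    using inverse_word_cong[OF u(1)] u by (simp add: word_class_mult presented_group_one word_class_eq_iff)
  then show "\<exists>y\<in>carrier ?G. y \<otimes>\<^bsub>?G\<^esub> x = \<one>\<^bsub>?G\<^esub>"
    using inverse_word_cong[OF u(1)] by (intro bexI[of _ "word_class X R (inverse_word u)"]) auto
qed

lemma inv_letter_class:
  assumes "x \<in> X"
  shows "inv\<^bsub>presented_group X R\<^esub> word_class X R [(b, x)] = word_class X R [(\<not> b, x)]"
proof (rule group.inv_equality[OF group_presented_group])
  show "word_class X R [(\<not> b, x)] \<otimes>\<^bsub>presented_group X R\<^esub> word_class X R [(b, x)] = \<one>\<^bsub>presented_group X R\<^esub>"
    using assms group_cong.cancel[of x X "\<not> b" R]
    by (simp add: word_class_mult presented_group_one word_class_eq_iff)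
qed (use assms in auto)

text \<open>Positive letters are enough, since the class of an inverse letter is the inverse of a
  positive one. This is applied to the image of the semigroup.\<close>

lemma generate_presented_group:
  assumes "B \<subseteq> carrier (presented_group X R)" "\<And>x. x \<in> X \<Longrightarrow> word_class X R [(True, x)] \<in> B"
  shows "generate (presented_group X R) B = carrier (presented_group X R)"
proof
  let ?G = "presented_group X R"
  interpret group ?G by (rule group_presented_group)
  show "generate ?G B \<subseteq> carrier ?G" using generate_incl[OF assms(1)] .
  have "word_class X R w \<in> generate ?G B" if "w \<in> lists (UNIV \<times> X)" for w
    using that
  proof (induction w)
    case Nil
    then show ?case using generate.one[of ?G B] by (simp add: presented_group_one)
  next
    case (Cons l w)
    obtain b x where l: "l = (b, x)" by (cases l)
    have x: "x \<in> X" "w \<in> lists (UNIV \<times> X)" using Cons l by auto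
    have "word_class X R [l] \<in> generate ?G B"
    proof (cases b)
      case True
      then show ?thesis using generate.incl[OF assms(2)[OF x(1)]] l by simp
    next
      case False
      then show ?thesis using generate.inv[OF assms(2)[OF x(1)]] inv_letter_class[OF x(1), of True] l
        by (metis (full_types))
    qed
    from generate.eng[OF this Cons.IH] have
      "word_class X R [l] \<otimes>\<^bsub>?G\<^esub> word_class X R w \<in> generate ?G B" using x l by auto
    then show ?case using word_class_mult[of "[l]" w] x l by simp
  qed
  then show "carrier ?G \<subseteq> generate ?G B" by (intro subsetI) (erule presented_groupE, simp)
qed

text \<open>Von Dyck's theorem. Evaluation of words respects every rule of the congruence, so it can
  be read off any chosen representative of a class.\<close>

lemma presented_group_lift:
  assumes H: "group H" and f: "\<And>x. x \<in> X \<Longrightarrow> f x \<in> carrier H"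
  defines "ev \<equiv> \<lambda>w. foldr (\<lambda>(b, x) a. (if b then f x else inv\<^bsub>H\<^esub> f x) \<otimes>\<^bsub>H\<^esub> a) w \<one>\<^bsub>H\<^esub>"
  assumes rels: "\<And>u v. (u, v) \<in> R \<Longrightarrow> ev u = ev v"
  shows "\<exists>h\<in>hom (presented_group X R) H. \<forall>w\<in>lists (UNIV \<times> X). h (word_class X R w) = ev w"
proof -
  interpret H: group H by (rule H)
  have ev_simps: "ev [] = \<one>\<^bsub>H\<^esub>"
    "ev ((b, x) # w) = (if b then f x else inv\<^bsub>H\<^esub> f x) \<otimes>\<^bsub>H\<^esub> ev w" for b x w
    by (simp_all add: ev_def)
  have ev_closed: "ev w \<in> carrier H" if "w \<in> lists (UNIV \<times> X)" for w
    using that by (induction w) (auto simp: ev_simps f)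
  have ev_append: "ev (u @ v) = ev u \<otimes>\<^bsub>H\<^esub> ev v"
    if "u \<in> lists (UNIV \<times> X)" "v \<in> lists (UNIV \<times> X)" for u v
    using that(1)
  proof (induction u)
    case (Cons l u)
    obtain b x where "l = (b, x)" by (cases l)
    with Cons show ?case using ev_closed[of u] ev_closed[OF that(2)] by (simp add: ev_simps f H.m_assoc)
  qed (simp add: ev_simps ev_closed that)
  have ev_cong: "ev u = ev v" if "(u, v) \<in> group_cong X R" for u v
    using that
  proof (induction rule: group_cong.induct)
    case (cancel x b)
    then show ?case by (auto simp: ev_simps f)
  next
    case (mult u v u' v')
    then show ?case using group_cong_in_lists[of u v] group_cong_in_lists[of u' v'] by (simp add: ev_append)
  qed (simp_all add: rels)
  define h where "h C = ev (SOME w. w \<in> C)" for C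
  have h: "h (word_class X R w) = ev w" if "w \<in> lists (UNIV \<times> X)" for w
  proof -
    have "w \<in> word_class X R w" using that by (auto intro: group_cong.refl)
    then have "(SOME v. v \<in> word_class X R w) \<in> word_class X R w" by (rule someI)
    then show ?thesis unfolding h_def using ev_cong by (metis Image_singleton_iff)
  qed
  have "h \<in> hom (presented_group X R) H"
  proof (rule homI)
    fix x assume "x \<in> carrier (presented_group X R)"
    then show "h x \<in> carrier H" by (elim presented_groupE) (simp add: h ev_closed)
  next
    fix x y assume "x \<in> carrier (presented_group X R)" "y \<in> carrier (presented_group X R)"
    then show "h (x \<otimes>\<^bsub>presented_group X R\<^esub> y) = h x \<otimes>\<^bsub>H\<^esub> h y"
      by (elim presented_groupE) (simp add: word_class_mult h ev_append)
  qed
  with h show ?thesis by blast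
qed

end


section \<open>Equational Noetherianity of free groups\<close>

text \<open>Congruent words act alike, so any representative will do, and choosing one keeps the
  alphabet out of the definition.\<close>

definition free_act :: "nat gword set \<Rightarrow> real \<times> real \<Rightarrow> real \<times> real" where
  "free_act C = word_act (SOME w. w \<in> C)"

lemma free_act_class:
  assumes "w \<in> lists (UNIV \<times> Y)"
  shows "free_act (word_class Y {} w) = word_act w"
proof -
  have "w \<in> word_class Y {} w" using assms by (auto intro: group_cong.refl)
  then have "(SOME v. v \<in> word_class Y {} w) \<in> word_class Y {} w" by (rule someI)
  then show ?thesis unfolding free_act_def using group_cong_word_act by (metis Image_singleton_iff)
qed

lemma group_free_group: "group (free_group Y)"
  unfolding free_group_def by (rule group_presented_group) simp

lemma free_groupE:
  assumes "C \<in> carrier (free_group Y)"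
  obtains w where "w \<in> lists (UNIV \<times> Y)" "C = word_class Y {} w"
  using assms presented_groupE[of "{}" Y C] unfolding free_group_def by blast

lemma free_act_mult:
  assumes "C \<in> carrier (free_group Y)" "D \<in> carrier (free_group Y)"
  shows "free_act (C \<otimes>\<^bsub>free_group Y\<^esub> D) v = free_act C (free_act D v)"
  using assms
  by (elim free_groupE) (simp add: free_group_def word_class_mult free_act_class)

lemma free_act_one: "free_act \<one>\<^bsub>free_group Y\<^esub> v = v"
  by (simp add: free_group_def presented_group_one free_act_class)

lemma free_act_linear:
  "free_act C (p, q) =
    (p * fst (free_act C (1, 0)) + q * fst (free_act C (0, 1)),
     p * snd (free_act C (1, 0)) + q * snd (free_act C (0, 1)))"
  unfolding free_act_def by (rule word_act_linear)

lemma free_act_faithful: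
  assumes "C \<in> carrier (free_group Y)" "free_act C (1, 0) = (1, 0)"
  shows "C = \<one>\<^bsub>free_group Y\<^esub>"
  using assms(1)
proof (rule free_groupE)
  fix w assume w: "w \<in> lists (UNIV \<times> Y)" "C = word_class Y {} w"
  then have "(w, []) \<in> group_cong Y {}"
    using assms(2) by (intro word_act_eq_imp_trivial) (simp_all add: free_act_class)
  then show ?thesis using w by (simp add: free_group_def presented_group_one word_class_eq_iff)
qed

text \<open>The matrix entries of \<open>h g\<close>, as functions of the homomorphism \<open>h\<close>, lie in a finitely generated,
  hence Noetherian, ring of functions; a system of equations amounts to an ideal in it.\<close>

theorem free_group_equationally_noetherian:
  fixes G :: "'g monoid" and Y :: "nat set"
  assumes G: "group G" and A: "finite A" "A \<subseteq> carrier G" "generate G A = carrier G"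
    and K: "K \<subseteq> carrier G"
  shows "\<exists>K0\<subseteq>K. finite K0 \<and>
    (\<forall>h\<in>hom G (free_group Y). (\<forall>g\<in>K0. h g = \<one>\<^bsub>free_group Y\<^esub>) \<longrightarrow> (\<forall>g\<in>K. h g = \<one>\<^bsub>free_group Y\<^esub>))"
proof -
  interpret G: group G by (rule G)
  interpret F: group "free_group Y" by (rule group_free_group)
  \<comment> \<open>The entries are elements of a ring of functions on all maps \<open>h\<close>, so
    identities between them must hold at every \<open>h\<close>. Maps that are not homomorphisms are
    therefore replaced by the trivial one.\<close>
  define \<rho> where "\<rho> h g =
      free_act ((if h \<in> hom G (free_group Y) then h else (\<lambda>_. \<one>\<^bsub>free_group Y\<^esub>)) g)" for h g
  have \<rho>_mult: "\<rho> h (x \<otimes>\<^bsub>G\<^esub> y) v = \<rho> h x (\<rho> h y v)" if "x \<in> carrier G" "y \<in> carrier G" for h x y v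
    using that by (auto simp: \<rho>_def hom_mult hom_in_carrier free_act_mult free_act_one)
  have \<rho>_one: "\<rho> h \<one>\<^bsub>G\<^esub> v = v" for h v
    by (auto simp: \<rho>_def free_act_one hom_one[OF _ G group_free_group])
  have \<rho>_linear: "\<rho> h g v = (fst v * fst (\<rho> h g (1, 0)) + snd v * fst (\<rho> h g (0, 1)),
      fst v * snd (\<rho> h g (1, 0)) + snd v * snd (\<rho> h g (0, 1)))" for h g v
    unfolding \<rho>_def using free_act_linear[of _ "fst v" "snd v"] by simp
  define E1 where "E1 v g = (\<lambda>h. fst (\<rho> h g v))" for v g
  define E2 where "E2 v g = (\<lambda>h. snd (\<rho> h g v))" for v g
  \<comment> \<open>Matrix multiplication, read entrywise: this keeps the entries of products inside
    the ring.\<close>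
  have E_mult: "E1 v (x \<otimes>\<^bsub>G\<^esub> y) = E1 v y * E1 (1, 0) x + E2 v y * E1 (0, 1) x"
    "E2 v (x \<otimes>\<^bsub>G\<^esub> y) = E1 v y * E2 (1, 0) x + E2 v y * E2 (0, 1) x"
    if "x \<in> carrier G" "y \<in> carrier G" for x y v
    unfolding E1_def E2_def by (rule ext, subst \<rho>_mult[OF that], subst \<rho>_linear, simp)+
  let ?B = "{(1, 0), (0, 1)} :: (real \<times> real) set"
  \<comment> \<open>\<open>generate\<close> also uses the inverses of the generators, so their
    entries have to be adjoined too.\<close>
  let ?A = "A \<union> (\<lambda>a. inv\<^bsub>G\<^esub> a) ` A"
  let ?C = "range (\<lambda>c (_ :: 'g \<Rightarrow> nat gword set). c :: real)"
  have "finite (\<Union>v\<in>?B. E1 v ` ?A \<union> E2 v ` ?A)" using A by simp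
  from noetherian_extend_finite[OF this noetherian_constants] obtain \<O> where
    \<O>: "noetherian_subring \<O>" "?C \<subseteq> \<O>" "(\<Union>v\<in>?B. E1 v ` ?A \<union> E2 v ` ?A) \<subseteq> \<O>" by blast
  have sub: "unital_subring \<O>" using \<O>(1) by (simp add: noetherian_subring_def)
  note \<O>D = unital_subringD[OF sub]
  have gen: "\<forall>v\<in>?B. E1 v a \<in> \<O> \<and> E2 v a \<in> \<O>" if "a \<in> ?A" for a
  proof (intro ballI conjI; rule subsetD[OF \<O>(3)])
    fix v assume "v \<in> ?B"
    then show "E1 v a \<in> (\<Union>v\<in>?B. E1 v ` ?A \<union> E2 v ` ?A)" "E2 v a \<in> (\<Union>v\<in>?B. E1 v ` ?A \<union> E2 v ` ?A)"
      using that by (blast intro: UN_I)+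
  qed
  have "\<forall>v\<in>?B. E1 v g \<in> \<O> \<and> E2 v g \<in> \<O>" if "g \<in> generate G A" for g
    using that
  proof induction
    case one
    have "E1 v \<one>\<^bsub>G\<^esub> = (\<lambda>_. fst v)" "E2 v \<one>\<^bsub>G\<^esub> = (\<lambda>_. snd v)" for v
      by (auto simp: E1_def E2_def \<rho>_one)
    then show ?case using \<O>(2) by auto
  next
    case (eng x y)
    then have xy: "x \<in> carrier G" "y \<in> carrier G" using A by auto
    show ?case
      unfolding E_mult[OF xy] using eng.IH by (intro ballI conjI \<O>D(4,6)) auto
  qed (simp_all add: gen)
  then have E: "E1 (1, 0) g \<in> \<O>" "E2 (1, 0) g \<in> \<O>" if "g \<in> carrier G" for g
    using that A(3) by auto
  \<comment> \<open>For a homomorphism \<open>h\<close>, both \<open>D1 g\<close> and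
    \<open>E2 (1, 0) g\<close> vanish at \<open>h\<close> exactly when \<open>h g\<close> fixes
    \<open>(1, 0)\<close>, which by faithfulness means that \<open>h g\<close> is trivial.\<close>
  define D1 where "D1 g = E1 (1, 0) g - 1" for g
  have "D1 ` K \<union> E2 (1, 0) ` K \<subseteq> \<O>" using E K \<O>D unfolding D1_def by auto
  from noetherian_subring_finite_subset[OF \<O>(1) this] obtain F where
    F: "finite F" "F \<subseteq> D1 ` K \<union> E2 (1, 0) ` K" "D1 ` K \<union> E2 (1, 0) ` K \<subseteq> ideal_span \<O> F" by blast
  have "\<forall>e\<in>F. \<exists>g\<in>K. e = D1 g \<or> e = E2 (1, 0) g" using F(2) by blast
  \<comment> \<open>Each basis element of the ideal is one of the two equations of some
    \<open>r e\<close> in \<open>K\<close>; these \<open>r e\<close> form the finite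
    subsystem.\<close>
  then obtain r where r: "\<And>e. e \<in> F \<Longrightarrow> r e \<in> K \<and> (e = D1 (r e) \<or> e = E2 (1, 0) (r e))" by metis
  show ?thesis
  proof (intro exI[of _ "r ` F"] conjI ballI impI)
    show "r ` F \<subseteq> K" "finite (r ` F)" using r F(1) by auto
    fix h g assume h: "h \<in> hom G (free_group Y)" "\<forall>g\<in>r ` F. h g = \<one>\<^bsub>free_group Y\<^esub>" and g: "g \<in> K"
    have F0: "e h = 0" if "e \<in> F" for e
    proof -
      have "\<rho> h (r e) (1, 0) = (1, 0)" using h that by (simp add: \<rho>_def free_act_one)
      then have "D1 (r e) h = 0" "E2 (1, 0) (r e) h = 0" by (simp_all add: D1_def E1_def E2_def)
      then show ?thesis using r[OF that] by metis
    qed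
    \<comment> \<open>Evaluation at \<open>h\<close> is a ring homomorphism, so the common zeros of
      \<open>F\<close> are zeros of everything that \<open>F\<close> spans.\<close>
    have "e h = 0" if "e \<in> ideal_span \<O> F" for e
      using that by (induction rule: ideal_span.induct) (simp_all add: F0)
    then have "D1 g h = 0" "E2 (1, 0) g h = 0" using F(3) g by blast+
    then have "free_act (h g) (1, 0) = (1, 0)"
      using h by (simp add: D1_def E1_def E2_def \<rho>_def prod_eq_iff)
    then show "h g = \<one>\<^bsub>free_group Y\<^esub>"
      using free_act_faithful hom_in_carrier[OF h(1)] g K by blast
  qed
qed

section \<open>Limit kernels of a pair\<close>

text \<open>Every element is the product of a word over the finite set of generators and their
  inverses. The enumeration obtained is used to build a convergent sequence.\<close>

lemma countable_fg_group:
  assumes "group G" "fg_group G"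
  shows "countable (carrier G)"
proof -
  interpret group G by fact
  obtain A where A: "finite A" "A \<subseteq> carrier G" "generate G A = carrier G"
    using assms(2) by (auto simp: fg_group_def)
  define p where "p l = foldr (\<otimes>\<^bsub>G\<^esub>) l \<one>\<^bsub>G\<^esub>" for l
  let ?B = "A \<union> (\<lambda>a. inv\<^bsub>G\<^esub> a) ` A"
  have p_closed: "p l \<in> carrier G" if "l \<in> lists ?B" for l
    using that A(2) by (induction l) (auto simp: p_def)
  have p_append: "p (u @ v) = p u \<otimes>\<^bsub>G\<^esub> p v" if "u \<in> lists ?B" "v \<in> lists ?B" for u v
    using that(1)
  proof (induction u)
    case (Cons l u)
    then have "l \<in> carrier G" "p u \<in> carrier G" using A(2) p_closed by auto
    with Cons show ?case using p_closed[OF that(2)] by (simp add: p_def m_assoc)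
  qed (use p_closed[OF that(2)] in \<open>simp add: p_def\<close>)
  have single: "b \<in> p ` lists ?B" if b: "b \<in> ?B" for b
  proof
    show "[b] \<in> lists ?B" using b by simp
    show "b = p [b]" using b A(2) by (auto simp: p_def)
  qed
  have "g \<in> p ` lists ?B" if "g \<in> generate G A" for g
    using that
  proof induction
    case one
    then show ?case by (auto simp: p_def intro!: image_eqI[of _ _ "[]"])
  next
    case (eng x y)
    then obtain u v where "x = p u" "y = p v" "u \<in> lists ?B" "v \<in> lists ?B" by blast
    then show ?case using p_append[of u v] by (intro image_eqI[of _ _ "u @ v"]) auto
  qed (use single in auto)
  then have "carrier G \<subseteq> p ` lists ?B" using A(3) by blast
  moreover have "countable (p ` lists ?B)" using A(1) by (auto intro: countable_finite)
  ultimately show ?thesis by (rule countable_subset)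
qed

section \<open>Kernels, factorization and domination\<close>

lemma hom_eq_if_kernel_subset:
  assumes "group G" "group H" "group H'" "\<phi> \<in> hom G H" "\<psi> \<in> hom G H'"
    and ker: "kernel G H \<phi> \<subseteq> kernel G H' \<psi>"
    and xy: "x \<in> carrier G" "y \<in> carrier G" "\<phi> x = \<phi> y"
  shows "\<psi> x = \<psi> y"
proof -
  interpret \<phi>: group_hom G H \<phi> by (intro group_hom.intro group_hom_axioms.intro assms)
  interpret \<psi>: group_hom G H' \<psi> by (intro group_hom.intro group_hom_axioms.intro assms)
  have "x \<otimes>\<^bsub>G\<^esub> inv\<^bsub>G\<^esub> y \<in> kernel G H \<phi>" using xy by (simp add: kernel_def)
  then have "x \<otimes>\<^bsub>G\<^esub> inv\<^bsub>G\<^esub> y \<in> kernel G H' \<psi>" using ker by blast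
  then have "\<psi> x \<otimes>\<^bsub>H'\<^esub> inv\<^bsub>H'\<^esub> \<psi> y = \<one>\<^bsub>H'\<^esub>" using xy by (simp add: kernel_def)
  then show ?thesis using xy \<psi>.H.inv_equality \<psi>.H.inv_inv by (metis \<psi>.H.inv_closed \<psi>.hom_closed)
qed

text \<open>The induced map sends \<open>\<phi> g\<close> to \<open>\<psi> g\<close>. It respects
  the semigroups because \<open>\<phi>\<close> maps the semigroup of \<open>P\<close> onto that of
  \<open>Q\<close>, so each element there has a preimage on which \<open>\<psi>\<close> is already
  controlled.\<close>

lemma pair_quotient_map_factor:
  assumes "group (grp P)" "group (grp Q)" "group (grp Q')"
    and \<phi>: "\<phi> \<in> pair_quotient_map P Q" and \<psi>: "\<psi> \<in> pair_hom P Q'"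
    and sub: "sgp_image P \<subseteq> carrier (grp P)"
    and ker: "kernel (grp P) (grp Q) \<phi> \<subseteq> kernel (grp P) (grp Q') \<psi>"
  shows "\<exists>u\<in>pair_hom Q Q'. \<forall>g\<in>carrier (grp P). \<psi> g = u (\<phi> g)"
proof -
  have \<phi>': "\<phi> \<in> hom (grp P) (grp Q)" "\<phi> ` carrier (grp P) = carrier (grp Q)"
    "\<phi> ` sgp_image P = sgp_image Q"
    and \<psi>': "\<psi> \<in> hom (grp P) (grp Q')" "\<psi> ` sgp_image P \<subseteq> sgp_image Q'"
    using \<phi> \<psi> by (auto simp: pair_quotient_map_def pair_hom_def)
  interpret P: group "grp P" by fact
  define u where "u y = \<psi> (SOME g. g \<in> carrier (grp P) \<and> \<phi> g = y)" for y
  have u: "u (\<phi> g) = \<psi> g" if "g \<in> carrier (grp P)" for g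
  proof -
    have "(SOME g'. g' \<in> carrier (grp P) \<and> \<phi> g' = \<phi> g) \<in> carrier (grp P) \<and>
      \<phi> (SOME g'. g' \<in> carrier (grp P) \<and> \<phi> g' = \<phi> g) = \<phi> g"
      by (rule someI[of _ g]) (use that in simp)
    then show ?thesis
      unfolding u_def using that by (intro hom_eq_if_kernel_subset[OF assms(1-3) \<phi>'(1) \<psi>'(1) ker]) auto
  qed
  have "u \<in> hom (grp Q) (grp Q')"
  proof (rule homI)
    fix x assume "x \<in> carrier (grp Q)"
    then obtain g where "g \<in> carrier (grp P)" "x = \<phi> g" using \<phi>'(2) by blast
    then show "u x \<in> carrier (grp Q')" using u hom_in_carrier[OF \<psi>'(1)] by simp
  next
    fix x y assume "x \<in> carrier (grp Q)" "y \<in> carrier (grp Q)"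
    then obtain g g' where g: "g \<in> carrier (grp P)" "x = \<phi> g" "g' \<in> carrier (grp P)" "y = \<phi> g'"
      using \<phi>'(2) by blast
    then have "x \<otimes>\<^bsub>grp Q\<^esub> y = \<phi> (g \<otimes>\<^bsub>grp P\<^esub> g')" using hom_mult[OF \<phi>'(1)] by simp
    then show "u (x \<otimes>\<^bsub>grp Q\<^esub> y) = u x \<otimes>\<^bsub>grp Q'\<^esub> u y" using u g hom_mult[OF \<psi>'(1)] by simp
  qed
  moreover have "u ` sgp_image Q \<subseteq> sgp_image Q'"
  proof -
    have "u ` sgp_image Q = \<psi> ` sgp_image P"
      unfolding \<phi>'(3)[symmetric] image_image using u sub by (intro image_cong) auto
    then show ?thesis using \<psi>'(2) by simp
  qed
  ultimately show ?thesis using u by (intro bexI[of _ u]) (auto simp: pair_hom_def)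
qed

text \<open>With this, maximality of a quotient becomes minimality of its kernel, and isomorphism
  under \<open>P\<close> becomes equality of kernels.\<close>

lemma dominates_iff_kernel_subset:
  assumes "group (grp P)" "group (grp Q)" "group (grp Q')"
    and \<phi>: "\<phi> \<in> pair_quotient_map P Q" and \<psi>: "\<psi> \<in> pair_quotient_map P Q'"
    and sub: "sgp_image P \<subseteq> carrier (grp P)"
  shows "dominates P Q \<phi> Q' \<psi> \<longleftrightarrow> kernel (grp P) (grp Q) \<phi> \<subseteq> kernel (grp P) (grp Q') \<psi>"
proof
  assume "dominates P Q \<phi> Q' \<psi>"
  then obtain u where u: "u \<in> hom (grp Q) (grp Q')" "\<forall>g\<in>carrier (grp P). \<psi> g = u (\<phi> g)"
    by (auto simp: dominates_def pair_hom_def)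
  then show "kernel (grp P) (grp Q) \<phi> \<subseteq> kernel (grp P) (grp Q') \<psi>"
    using hom_one[OF u(1) assms(2,3)] by (auto simp: kernel_def)
next
  assume "kernel (grp P) (grp Q) \<phi> \<subseteq> kernel (grp P) (grp Q') \<psi>"
  then show "dominates P Q \<phi> Q' \<psi>"
    unfolding dominates_def using \<psi>
    by (intro pair_quotient_map_factor[OF assms(1-3) \<phi> _ sub]) (auto simp: pair_quotient_map_def)
qed

lemma grp_incl_pair [simp]: "grp (incl_pair T L) = L"
  by (simp add: incl_pair_def)

lemma is_pair_incl_pair:
  assumes "group L" "T \<subseteq> carrier L" "\<And>x y. x \<in> T \<Longrightarrow> y \<in> T \<Longrightarrow> x \<otimes>\<^bsub>L\<^esub> y \<in> T"
    and "generate L T = carrier L"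
  shows "is_pair (incl_pair T L)"
proof -
  interpret group L by fact
  have "x \<in> carrier L" if "x \<in> T" for x using that assms(2) by blast
  then show ?thesis
    using assms(3,4) is_group
    by (simp add: is_pair_def is_semigroup_def incl_pair_def hom_def m_assoc)
qed

section \<open>Limit kernels and limit pairs\<close>

definition kills :: "nat \<Rightarrow> ('g \<Rightarrow> nat gword set) \<Rightarrow> 'g set \<Rightarrow> bool" where
  "kills k h K \<longleftrightarrow> (\<forall>g\<in>K. h g = \<one>\<^bsub>free_group {..<k}\<^esub>)"

text \<open>By Noetherianity these are the kernels of the limits of pair homomorphisms: the kernels of a
  convergent sequence contain the stable kernel eventually.\<close>

definition limit_kernel :: "nat \<Rightarrow> ('s, 'g) pair \<Rightarrow> 'g set \<Rightarrow> bool" where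
  "limit_kernel k P K \<longleftrightarrow> K \<subseteq> carrier (grp P) \<and>
     (\<forall>A. finite A \<and> A \<subseteq> carrier (grp P) - K \<longrightarrow>
       (\<exists>h\<in>pair_hom P (free_pair k). kills k h K \<and> (\<forall>a\<in>A. h a \<noteq> \<one>\<^bsub>free_group {..<k}\<^esub>)))"

definition quotient_pair_map :: "('s, 'g) pair \<Rightarrow> 'g set \<Rightarrow> 'g \<Rightarrow> 'g set" where
  "quotient_pair_map P K g = K #>\<^bsub>grp P\<^esub> g"

abbreviation quotient_pair :: "('s, 'g) pair \<Rightarrow> 'g set \<Rightarrow> ('g set, 'g set) pair" where
  "quotient_pair P K \<equiv> incl_pair (quotient_pair_map P K ` sgp_image P) (grp P Mod K)"

locale fg_pair =
  fixes P :: "('s, 'g) pair" and k :: nat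
  assumes P: "is_pair P" and fg: "fg_group (grp P)"
begin

abbreviation "G \<equiv> grp P"
abbreviation "F \<equiv> free_group {..<k}"
abbreviation "\<H> \<equiv> pair_hom P (free_pair k)"

interpretation G: group G using P by (simp add: is_pair_def)

lemma \<H>_hom: "h \<in> \<H> \<Longrightarrow> h \<in> hom G F"
  by (simp add: pair_hom_def free_pair_def)

lemma sgp_image_subset: "sgp_image P \<subseteq> carrier G"
  using P hom_in_carrier by (fastforce simp: is_pair_def sgp_image_def)

lemma \<H>_noetherian:
  assumes "K \<subseteq> carrier G"
  obtains K0 where "K0 \<subseteq> K" "finite K0" "\<And>h. h \<in> \<H> \<Longrightarrow> kills k h K0 \<Longrightarrow> kills k h K"
proof -
  obtain A where A: "finite A" "A \<subseteq> carrier G" "generate G A = carrier G"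
    using fg by (auto simp: fg_group_def)
  obtain K0 where "K0 \<subseteq> K" "finite K0"
    "\<forall>h\<in>hom G F. (\<forall>g\<in>K0. h g = \<one>\<^bsub>F\<^esub>) \<longrightarrow> (\<forall>g\<in>K. h g = \<one>\<^bsub>F\<^esub>)"
    using free_group_equationally_noetherian[OF G.is_group A assms] by blast
  then show ?thesis
    using \<H>_hom by (intro that[of K0]) (simp_all add: kills_def)
qed

lemma limit_kernelD:
  assumes "limit_kernel k P K" "finite A" "A \<subseteq> carrier G" "A \<inter> K = {}"
  obtains h where "h \<in> \<H>" "kills k h K" "\<And>a. a \<in> A \<Longrightarrow> h a \<noteq> \<one>\<^bsub>F\<^esub>"
  using assms unfolding limit_kernel_def by (metis Diff_eq Int_commute Int_greatest disjoint_eq_subset_Compl)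

text \<open>Separation of the single element \<open>x\<close>: a limit kernel is the common kernel
  of the pair homomorphisms that kill it, and so inherits the closure properties of kernels.\<close>

lemma limit_kernel_memI:
  assumes "limit_kernel k P K" "x \<in> carrier G" "\<And>h. h \<in> \<H> \<Longrightarrow> kills k h K \<Longrightarrow> h x = \<one>\<^bsub>F\<^esub>"
  shows "x \<in> K"
  using limit_kernelD[OF assms(1), of "{x}"] assms(2,3) by blast

lemma limit_kernel_normal:
  assumes K: "limit_kernel k P K"
  shows "K \<lhd> G"
proof -
  have KG: "K \<subseteq> carrier G" using K by (simp add: limit_kernel_def)
  have hom: "group_hom G F h" if "h \<in> \<H>" for h
    using that \<H>_hom by (intro group_hom.intro group_hom_axioms.intro G.is_group group_free_group)
  have kill: "h x = \<one>\<^bsub>F\<^esub>" if "kills k h K" "x \<in> K" for h x using that by (simp add: kills_def)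
  have "subgroup K G"
  proof (rule G.subgroupI)
    show "K \<subseteq> carrier G" by (rule KG)
    have "\<one>\<^bsub>G\<^esub> \<in> K"
      by (rule limit_kernel_memI[OF K]) (simp_all add: group_hom.hom_one[OF hom])
    then show "K \<noteq> {}" by blast
    show "inv\<^bsub>G\<^esub> x \<in> K" if x: "x \<in> K" for x
    proof (rule limit_kernel_memI[OF K])
      show "h (inv\<^bsub>G\<^esub> x) = \<one>\<^bsub>F\<^esub>" if "h \<in> \<H>" "kills k h K" for h
      proof -
        interpret group_hom G F h using hom that(1) .
        show ?thesis using kill[OF that(2) x] x KG by auto
      qed
    qed (use x KG in auto)
    show "x \<otimes>\<^bsub>G\<^esub> y \<in> K" if xy: "x \<in> K" "y \<in> K" for x y
    proof (rule limit_kernel_memI[OF K])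
      show "h (x \<otimes>\<^bsub>G\<^esub> y) = \<one>\<^bsub>F\<^esub>" if "h \<in> \<H>" "kills k h K" for h
      proof -
        interpret group_hom G F h using hom that(1) .
        have "x \<in> carrier G" "y \<in> carrier G" using xy KG by auto
        then show ?thesis using kill[OF that(2)] xy by simp
      qed
    qed (use xy KG in auto)
  qed
  then show ?thesis
  proof (rule G.normal_invI)
    fix x y assume xy: "x \<in> carrier G" "y \<in> K"
    then have y: "y \<in> carrier G" using KG by blast
    show "x \<otimes>\<^bsub>G\<^esub> y \<otimes>\<^bsub>G\<^esub> inv\<^bsub>G\<^esub> x \<in> K"
    proof (rule limit_kernel_memI[OF K])
      show "h (x \<otimes>\<^bsub>G\<^esub> y \<otimes>\<^bsub>G\<^esub> inv\<^bsub>G\<^esub> x) = \<one>\<^bsub>F\<^esub>" if "h \<in> \<H>" "kills k h K" for h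
      proof -
        interpret group_hom G F h using hom that(1) .
        show ?thesis using kill[OF that(2) xy(2)] xy y by simp
      qed
    qed (use xy y in auto)
  qed
qed

text \<open>The quotient is the group of cosets with the image of the semigroup. Separation of
  finite sets outside \<open>K\<close> is used twice: it makes the quotient fully residually free,
  and it yields the members of a convergent sequence with stable kernel \<open>K\<close>.\<close>

lemma limit_kernel_limit_pair:
  assumes K: "limit_kernel k P K"
  shows "limit_pair k P (quotient_pair P K) (quotient_pair_map P K)"
    and "kernel G (G Mod K) (quotient_pair_map P K) = K"
proof -
  let ?L = "G Mod K" and ?\<tau> = "quotient_pair_map P K"
  have KG: "K \<subseteq> carrier G" using K by (simp add: limit_kernel_def)
  interpret N: normal K G by (rule limit_kernel_normal[OF K])
  interpret L: group ?L by (rule N.factorgroup_is_group)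
  have \<tau>_hom: "?\<tau> \<in> hom G ?L" using N.r_coset_hom_Mod by (simp add: quotient_pair_map_def[abs_def])
  interpret \<tau>: group_hom G ?L ?\<tau> by (intro group_hom.intro group_hom_axioms.intro \<tau>_hom G.is_group L.is_group)
  have \<tau>_surj: "?\<tau> ` carrier G = carrier ?L" by (simp add: carrier_FactGroup quotient_pair_map_def[abs_def])
  show ker: "kernel G ?L ?\<tau> = K"
  proof -
    have "K #>\<^bsub>G\<^esub> g = K \<longleftrightarrow> g \<in> K" if "g \<in> carrier G" for g
      using that G.coset_join1[of K g] G.coset_join2[of g K] N.is_subgroup KG by blast
    then show ?thesis using KG by (auto simp: kernel_def quotient_pair_map_def)
  qed
  let ?Q = "quotient_pair P K"
  have Q [simp]: "grp ?Q = ?L" "sgp_image ?Q = ?\<tau> ` sgp_image P"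
    by (simp_all add: incl_pair_def sgp_image_def)
  have \<tau>_quot: "?\<tau> \<in> pair_quotient_map P ?Q"
    using \<tau>_hom \<tau>_surj by (simp add: pair_quotient_map_def pair_hom_def)
  have img_closed: "x \<otimes>\<^bsub>G\<^esub> y \<in> sgp_image P" if "x \<in> sgp_image P" "y \<in> sgp_image P" for x y
  proof -
    have "is_semigroup (sgp P)" "str P \<in> hom (sgp P) G" using P by (simp_all add: is_pair_def)
    then show ?thesis
      using that unfolding sgp_image_def is_semigroup_def by (smt (verit) hom_mult image_iff)
  qed
  have is_pair_Q: "is_pair ?Q"
  proof -
    let ?T = "?\<tau> ` sgp_image P"
    have TL: "?T \<subseteq> carrier ?L" using \<tau>_surj sgp_image_subset by blast
    have "x \<otimes>\<^bsub>?L\<^esub> y \<in> ?T" if xy: "x \<in> ?T" "y \<in> ?T" for x y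
    proof -
      obtain a b where ab: "a \<in> sgp_image P" "x = ?\<tau> a" "b \<in> sgp_image P" "y = ?\<tau> b"
        using xy by blast
      then have "a \<in> carrier G" "b \<in> carrier G" using sgp_image_subset by blast+
      then have "x \<otimes>\<^bsub>?L\<^esub> y = ?\<tau> (a \<otimes>\<^bsub>G\<^esub> b)" using \<tau>.hom_mult[of a b] ab by (simp only:)
      then show ?thesis using img_closed[OF ab(1,3)] by (rule image_eqI)
    qed
    moreover have "generate ?L ?T = carrier ?L"
      using \<tau>.generate_img[OF sgp_image_subset] P \<tau>_surj by (simp add: is_pair_def sgp_image_def)
    ultimately show ?thesis using TL by (intro is_pair_incl_pair L.is_group)
  qed
  have "limit_group ?L"
    unfolding limit_group_def
  proof (intro conjI L.is_group)
    obtain A where A: "finite A" "A \<subseteq> carrier G" "generate G A = carrier G"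
      using fg by (auto simp: fg_group_def)
    then show "fg_group ?L"
      unfolding fg_group_def using \<tau>.generate_img[OF A(2)] \<tau>_surj by (intro exI[of _ "?\<tau> ` A"]) auto
    show "fully_residually_free ?L"
      unfolding fully_residually_free_def
    proof (intro allI impI)
      fix A assume A: "finite A \<and> A \<subseteq> carrier ?L - {\<one>\<^bsub>?L\<^esub>}"
      then have "\<forall>a\<in>A. \<exists>g\<in>carrier G. ?\<tau> g = a" using \<tau>_surj by (metis DiffE image_iff subset_iff)
      \<comment> \<open>Nontrivial elements of the quotient are lifted to \<open>G\<close>, where
        they lie outside \<open>K\<close>. A homomorphism that separates the lifts and kills
        \<open>K\<close> descends.\<close>
      then obtain r where r: "\<And>a. a \<in> A \<Longrightarrow> r a \<in> carrier G \<and> ?\<tau> (r a) = a" by metis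
      have rK: "r a \<notin> K" if a: "a \<in> A" for a
      proof
        assume "r a \<in> K"
        then have "r a \<in> kernel G ?L ?\<tau>" by (simp only: ker)
        then have "a = \<one>\<^bsub>?L\<^esub>" using r[OF a] by (simp add: kernel_def)
        then show False using A a by blast
      qed
      then have "finite (r ` A)" "r ` A \<subseteq> carrier G" "r ` A \<inter> K = {}" using A r by auto
      then obtain h where h: "h \<in> \<H>" "kills k h K" "\<And>a. a \<in> r ` A \<Longrightarrow> h a \<noteq> \<one>\<^bsub>F\<^esub>"
        using limit_kernelD[OF K] by metis
      have "group (grp (free_pair k))" by (simp add: free_pair_def group_free_group)
      moreover have "kernel G (grp ?Q) ?\<tau> \<subseteq> kernel G (grp (free_pair k)) h"
        using h(2) KG unfolding Q ker by (auto simp: kernel_def kills_def free_pair_def)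
      ultimately obtain u where u: "u \<in> pair_hom ?Q (free_pair k)" "\<forall>g\<in>carrier G. h g = u (?\<tau> g)"
        using pair_quotient_map_factor[OF G.is_group _ _ \<tau>_quot h(1) sgp_image_subset] L.is_group by auto
      show "\<exists>(Y :: nat set). \<exists>\<phi>\<in>hom ?L (free_group Y). \<forall>a\<in>A. \<phi> a \<noteq> \<one>\<^bsub>free_group Y\<^esub>"
      proof (intro exI[of _ "{..<k}"] bexI[of _ u] ballI)
        show "u \<in> hom ?L F" using u(1) by (simp add: pair_hom_def free_pair_def)
        fix a assume "a \<in> A"
        then show "u a \<noteq> \<one>\<^bsub>F\<^esub>" using h(3)[of "r a"] u(2) r[of a] by auto
      qed
    qed
  qed
  moreover have "\<exists>h. convergent_seq P (free_pair k) h \<and> K = stable_kernel P (free_pair k) h"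
  proof -
    define e where "e = from_nat_into (carrier G)"
    have e: "\<exists>i. e i = g" if "g \<in> carrier G" for g
      using from_nat_into_surj[OF countable_fg_group[OF G.is_group fg] that] by (auto simp: e_def)
    \<comment> \<open>The \<open>n\<close>-th homomorphism kills \<open>K\<close> and keeps alive
      those of the first \<open>n\<close> listed elements that lie outside \<open>K\<close>, so
      every element is decided from some index on.\<close>
    have "\<forall>n. \<exists>h. h \<in> \<H> \<and> kills k h K \<and> (\<forall>a\<in>e ` {..<n} \<inter> (carrier G - K). h a \<noteq> \<one>\<^bsub>F\<^esub>)"
    proof
      fix n
      show "\<exists>h. h \<in> \<H> \<and> kills k h K \<and> (\<forall>a\<in>e ` {..<n} \<inter> (carrier G - K). h a \<noteq> \<one>\<^bsub>F\<^esub>)"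
        by (rule limit_kernelD[OF K, of "e ` {..<n} \<inter> (carrier G - K)"]) auto
    qed
    then obtain h where h: "\<And>n. h n \<in> \<H>" "\<And>n. kills k (h n) K"
      "\<And>n a. a \<in> e ` {..<n} \<inter> (carrier G - K) \<Longrightarrow> h n a \<noteq> \<one>\<^bsub>F\<^esub>" by metis
    have 1: "\<forall>\<^sub>F n in sequentially. h n g = \<one>\<^bsub>F\<^esub>" if "g \<in> K" for g
      using h(2) that by (simp add: kills_def)
    have 2: "\<forall>\<^sub>F n in sequentially. h n g \<noteq> \<one>\<^bsub>F\<^esub>" if g: "g \<in> carrier G - K" for g
    proof -
      obtain i where i: "e i = g" using e[of g] g by blast
      have "h n g \<noteq> \<one>\<^bsub>F\<^esub>" if "n \<ge> Suc i" for n
        using h(3)[of g n] i that g by auto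
      then show ?thesis unfolding eventually_sequentially by blast
    qed
    have F: "grp (free_pair k) = F" by (simp add: free_pair_def)
    have "\<not> (\<forall>\<^sub>F n in sequentially. h n g = \<one>\<^bsub>F\<^esub>)" if "g \<in> carrier G - K" for g
    proof
      assume "\<forall>\<^sub>F n in sequentially. h n g = \<one>\<^bsub>F\<^esub>"
      with 2[OF that] have "\<forall>\<^sub>F n in sequentially. False" by eventually_elim simp
      then show False by simp
    qed
    then have "stable_kernel P (free_pair k) h = K"
      using 1 KG unfolding stable_kernel_def F by blast
    moreover have "convergent_seq P (free_pair k) h"
      using 1 2 h(1) unfolding convergent_seq_def F by blast
    ultimately show ?thesis by blast
  qed
  ultimately show "limit_pair k P ?Q ?\<tau>"
    unfolding limit_pair_def Q ker using is_pair_Q \<tau>_quot by blast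
qed

text \<open>A late enough member of the convergent sequence serves as the separating homomorphism.
  It kills the whole stable kernel because it kills the finite subset \<open>K0\<close>, and
  convergence keeps each of the finitely many elements of \<open>A\<close> alive eventually.\<close>

lemma limit_pair_limit_kernel:
  assumes "limit_pair k P Q \<tau>"
  shows "limit_kernel k P (kernel G (grp Q) \<tau>)"
proof -
  let ?K = "kernel G (grp Q) \<tau>"
  obtain h where h: "convergent_seq P (free_pair k) h" "?K = stable_kernel P (free_pair k) h"
    using assms by (auto simp: limit_pair_def)
  have F: "grp (free_pair k) = F" by (simp add: free_pair_def)
  have hH: "h n \<in> \<H>" for n using h(1) by (simp add: convergent_seq_def)
  have KG: "?K \<subseteq> carrier G" by (auto simp: kernel_def)
  obtain K0 where K0: "K0 \<subseteq> ?K" "finite K0" "\<And>h. h \<in> \<H> \<Longrightarrow> kills k h K0 \<Longrightarrow> kills k h ?K"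
    using \<H>_noetherian[OF KG] by blast
  have "\<forall>\<^sub>F n in sequentially. h n g = \<one>\<^bsub>F\<^esub>" if "g \<in> K0" for g
    using that K0(1) unfolding h(2) stable_kernel_def F by blast
  then have "\<forall>\<^sub>F n in sequentially. \<forall>g\<in>K0. h n g = \<one>\<^bsub>F\<^esub>"
    using K0(2) by (simp add: eventually_ball_finite)
  then have ev: "\<forall>\<^sub>F n in sequentially. kills k (h n) ?K"
    by eventually_elim (use K0(3) hH in \<open>auto simp: kills_def\<close>)
  have "\<exists>h'\<in>\<H>. kills k h' ?K \<and> (\<forall>a\<in>A. h' a \<noteq> \<one>\<^bsub>F\<^esub>)" if A: "finite A" "A \<subseteq> carrier G - ?K" for A
  proof -
    have "\<forall>\<^sub>F n in sequentially. h n a \<noteq> \<one>\<^bsub>F\<^esub>" if "a \<in> A" for a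
      using h(1) that A(2) unfolding h(2) stable_kernel_def convergent_seq_def F by blast
    then have "\<forall>\<^sub>F n in sequentially. \<forall>a\<in>A. h n a \<noteq> \<one>\<^bsub>F\<^esub>"
      using A(1) by (simp add: eventually_ball_finite)
    with ev have "\<forall>\<^sub>F n in sequentially. kills k (h n) ?K \<and> (\<forall>a\<in>A. h n a \<noteq> \<one>\<^bsub>F\<^esub>)"
      by eventually_elim simp
    then obtain n where "kills k (h n) ?K \<and> (\<forall>a\<in>A. h n a \<noteq> \<one>\<^bsub>F\<^esub>)"
      by (auto simp: eventually_sequentially)
    then show ?thesis using hH by blast
  qed
  then show ?thesis using KG by (simp add: limit_kernel_def)
qed

text \<open>Noetherian induction, as in the decomposition of a closed set into irreducible ones: if the
  common kernel of the homomorphisms killing \<open>K\<close> is not a limit kernel, then finitely many proper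
  enlargements of \<open>K\<close> account for all these homomorphisms.\<close>

lemma limit_kernels_cover:
  assumes "K \<subseteq> carrier G"
  shows "\<exists>\<K>. finite \<K> \<and> (\<forall>K'\<in>\<K>. limit_kernel k P K') \<and>
    (\<forall>h\<in>\<H>. kills k h K \<longrightarrow> (\<exists>K'\<in>\<K>. kills k h K'))"
proof -
  \<comment> \<open>Going down in \<open>r\<close> adds an equation that some solution of the system
    violates, so the solution set shrinks strictly.\<close>
  define r where "r = {(insert a K, K) | a K. K \<subseteq> carrier G \<and> a \<in> carrier G \<and>
    (\<exists>h\<in>\<H>. kills k h K \<and> h a \<noteq> \<one>\<^bsub>F\<^esub>)}"
  have "wf r"
    unfolding wf_iff_no_infinite_down_chain
  proof (rule notI, elim exE)
    fix f assume f: "\<forall>i. (f (Suc i), f i) \<in> r"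
    have step: "\<exists>a h. f (Suc i) = insert a (f i) \<and> h \<in> \<H> \<and> kills k h (f i) \<and> h a \<noteq> \<one>\<^bsub>F\<^esub>"
      and sub: "f i \<subseteq> carrier G" for i
      using f[rule_format, of i] unfolding r_def by blast+
    have mono: "f i \<subseteq> f j" if "i \<le> j" for i j
      by (rule lift_Suc_mono_le[OF _ that]) (use step in blast)
    have "(\<Union>i. f i) \<subseteq> carrier G" using sub by blast
    then obtain K0 where K0: "K0 \<subseteq> (\<Union>i. f i)" "finite K0"
      "\<And>h. h \<in> \<H> \<Longrightarrow> kills k h K0 \<Longrightarrow> kills k h (\<Union>i. f i)"
      using \<H>_noetherian by blast
    have "\<exists>N. K0 \<subseteq> f N"
      using K0(2,1)
    proof (induction K0)
      case (insert x K0)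
      then obtain N i where "K0 \<subseteq> f N" "x \<in> f i" by auto
      then have "insert x K0 \<subseteq> f (max i N)" using mono[of i "max i N"] mono[of N "max i N"] by auto
      then show ?case ..
    qed simp
    then obtain N where N: "K0 \<subseteq> f N" ..
    \<comment> \<open>\<open>f N\<close> contains a finite subsystem for the whole union, so the
      solution of \<open>f N\<close> that violates the next equation is contradictory.\<close>
    obtain a h where ah: "f (Suc N) = insert a (f N)" "h \<in> \<H>" "kills k h (f N)" "h a \<noteq> \<one>\<^bsub>F\<^esub>"
      using step[of N] by blast
    have "kills k h K0" using ah(3) N unfolding kills_def by blast
    then have "kills k h (\<Union>i. f i)" using K0(3) ah(2) by blast
    moreover have "a \<in> (\<Union>i. f i)" using ah(1) by blast
    ultimately have "h a = \<one>\<^bsub>F\<^esub>" unfolding kills_def by (rule bspec)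
    then show False using ah(4) by contradiction
  qed
  then show ?thesis
    using assms
  proof (induction K rule: wf_induct_rule)
    case (less K)
    define Z where "Z = {h \<in> \<H>. kills k h K}"
    \<comment> \<open>The closure of \<open>K\<close>: the largest subset of
      \<open>carrier G\<close> killed by every homomorphism in \<open>Z\<close>. If it is a limit
      kernel, it covers \<open>Z\<close> alone.\<close>
    define K' where "K' = {g \<in> carrier G. \<forall>h\<in>Z. h g = \<one>\<^bsub>F\<^esub>}"
    have ZK': "kills k h K'" if "h \<in> Z" for h using that by (auto simp: K'_def kills_def)
    show ?case
    proof (cases "limit_kernel k P K'")
      case True
      then show ?thesis using ZK' by (intro exI[of _ "{K'}"]) (auto simp: Z_def)
    next
      case False
      have "K' \<subseteq> carrier G" by (auto simp: K'_def)
      \<comment> \<open>Failure of separation gives a finite \<open>A\<close> such that each member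
        of \<open>Z\<close> kills some \<open>a \<in> A\<close>; thus \<open>Z\<close> is the union
        of the solution sets of the systems \<open>insert a K\<close>. Each of these is smaller, as
        \<open>a\<close> lies outside the closure of \<open>K\<close>.\<close>
      with False obtain A where A: "finite A" "A \<subseteq> carrier G - K'"
        "\<And>h. h \<in> \<H> \<Longrightarrow> kills k h K' \<Longrightarrow> \<exists>a\<in>A. h a = \<one>\<^bsub>F\<^esub>"
        unfolding limit_kernel_def by meson
      have "\<exists>\<K>. finite \<K> \<and> (\<forall>K'\<in>\<K>. limit_kernel k P K') \<and>
        (\<forall>h\<in>\<H>. kills k h (insert a K) \<longrightarrow> (\<exists>K'\<in>\<K>. kills k h K'))" if "a \<in> A" for a
      proof (rule less.IH)
        have a: "a \<in> carrier G" "a \<notin> K'" using that A by auto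
        then have "\<exists>h\<in>\<H>. kills k h K \<and> h a \<noteq> \<one>\<^bsub>F\<^esub>" by (auto simp: K'_def Z_def)
        then show "(insert a K, K) \<in> r" using a less.prems by (auto simp: r_def)
        show "insert a K \<subseteq> carrier G" using a less.prems by blast
      qed
      then obtain \<K> where \<K>: "\<And>a. a \<in> A \<Longrightarrow> finite (\<K> a) \<and> (\<forall>K'\<in>\<K> a. limit_kernel k P K') \<and>
        (\<forall>h\<in>\<H>. kills k h (insert a K) \<longrightarrow> (\<exists>K'\<in>\<K> a. kills k h K'))" by metis
      show ?thesis
      proof (intro exI[of _ "\<Union>a\<in>A. \<K> a"] conjI ballI impI)
        show "finite (\<Union>a\<in>A. \<K> a)" using A(1) \<K> by blast
        show "limit_kernel k P K'" if "K' \<in> (\<Union>a\<in>A. \<K> a)" for K' using that \<K> by blast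
        fix h assume h: "h \<in> \<H>" "kills k h K"
        then obtain a where a: "a \<in> A" "h a = \<one>\<^bsub>F\<^esub>" using A(3)[of h] ZK'[of h] by (auto simp: Z_def)
        then have "kills k h (insert a K)" using h by (simp add: kills_def)
        then show "\<exists>K'\<in>\<Union>a\<in>A. \<K> a. kills k h K'" using \<K>[OF a(1)] h(1) a(1) by blast
      qed
    qed
  qed
qed

text \<open>A finite cover contains all minimal limit kernels, since every limit kernel lies above a
  member of the cover. Passing to the minimal ones keeps the covering property, because killing a
  set entails killing its subsets.\<close>

lemma finite_minimal_limit_kernels:
  obtains \<M> where "finite \<M>"
    "\<And>K. K \<in> \<M> \<longleftrightarrow> limit_kernel k P K \<and> (\<forall>K'. limit_kernel k P K' \<longrightarrow> K' \<subseteq> K \<longrightarrow> K \<subseteq> K')"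
    "\<And>h. h \<in> \<H> \<Longrightarrow> \<exists>K\<in>\<M>. kills k h K"
proof -
  obtain \<K> where \<K>: "finite \<K>" "\<And>K. K \<in> \<K> \<Longrightarrow> limit_kernel k P K"
    "\<And>h. h \<in> \<H> \<Longrightarrow> \<exists>K\<in>\<K>. kills k h K"
    using limit_kernels_cover[of "{}"] by (auto simp: kills_def)
  \<comment> \<open>Irreducibility: otherwise one element outside \<open>K\<close> is picked from
    each member of the cover, and a single homomorphism killing \<open>K\<close> avoids killing all
    these elements. It then kills no member of the cover.\<close>
  have below: "\<exists>K'\<in>\<K>. K' \<subseteq> K" if K: "limit_kernel k P K" for K
  proof (rule ccontr)
    assume "\<not> ?thesis"
    then have "\<forall>K'\<in>\<K>. \<exists>a\<in>K'. a \<notin> K" by blast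
    then obtain a where a: "\<And>K'. K' \<in> \<K> \<Longrightarrow> a K' \<in> K' \<and> a K' \<notin> K" by metis
    have "finite (a ` \<K>)" "a ` \<K> \<subseteq> carrier G" "a ` \<K> \<inter> K = {}"
      using a \<K>(1,2) unfolding limit_kernel_def by blast+
    then obtain h where h: "h \<in> \<H>" "\<And>x. x \<in> a ` \<K> \<Longrightarrow> h x \<noteq> \<one>\<^bsub>F\<^esub>"
      by (rule limit_kernelD[OF K]) blast
    then obtain K' where "K' \<in> \<K>" "kills k h K'" using \<K>(3) by blast
    then show False using h(2)[of "a K'"] a[of K'] by (simp add: kills_def)
  qed
  let ?m = "\<lambda>K. limit_kernel k P K \<and> (\<forall>K'. limit_kernel k P K' \<longrightarrow> K' \<subseteq> K \<longrightarrow> K \<subseteq> K')"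
  have "Collect ?m \<subseteq> \<K>"
  proof
    fix K assume K: "K \<in> Collect ?m"
    then obtain K' where "K' \<in> \<K>" "K' \<subseteq> K" using below[of K] by blast
    moreover from this have "K \<subseteq> K'" using K \<K>(2)[of K'] by simp
    ultimately show "K \<in> \<K>" by auto
  qed
  then have fin: "finite (Collect ?m)" using \<K>(1) finite_subset by blast
  have min_below: "\<exists>K'. ?m K' \<and> K' \<subseteq> K" if K: "limit_kernel k P K" for K
  proof -
    obtain K1 where K1: "K1 \<in> \<K>" "K1 \<subseteq> K" using below[OF K] by blast
    \<comment> \<open>A minimal member of the finite cover is minimal among all limit kernels, as
      any limit kernel below it contains a further member by \<open>below\<close>.\<close>
    then obtain K2 where K2: "K2 \<in> \<K>" "K2 \<subseteq> K1" "\<And>K'. K' \<in> \<K> \<Longrightarrow> K' \<subseteq> K2 \<Longrightarrow> K2 = K'"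
      using finite_has_minimal2[OF \<K>(1) K1(1)] by metis
    have "?m K2"
    proof (intro conjI allI impI)
      show "limit_kernel k P K2" using \<K>(2)[OF K2(1)] .
      fix K' assume "limit_kernel k P K'" "K' \<subseteq> K2"
      then obtain K3 where "K3 \<in> \<K>" "K3 \<subseteq> K'" using below[of K'] by blast
      then show "K2 \<subseteq> K'" using K2(3)[of K3] \<open>K' \<subseteq> K2\<close> by blast
    qed
    then show ?thesis using K2(2) \<open>K1 \<subseteq> K\<close> by (meson subset_trans)
  qed
  show ?thesis
  proof (rule that[of "Collect ?m"])
    fix h assume "h \<in> \<H>"
    then obtain K where K: "K \<in> \<K>" "kills k h K" using \<K>(3) by blast
    then obtain K' where K': "?m K'" "K' \<subseteq> K" using min_below[OF \<K>(2)] by meson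
    have "kills k h K'" using K(2) K'(2) unfolding kills_def by blast
    then show "\<exists>K\<in>Collect ?m. kills k h K" by (intro bexI[of _ K'] CollectI K'(1))
  qed (use fin in simp_all)
qed

section \<open>Maximal limit quotients and the canonical collection\<close>

lemma limit_pairD:
  assumes "limit_pair k P Q \<tau>"
  shows "group (grp Q)" "\<tau> \<in> pair_quotient_map P Q"
  using assms by (simp_all add: limit_pair_def is_pair_def)

lemma limit_pair_dominates_iff:
  assumes "limit_pair k P Q \<tau>" "limit_pair k P Q' \<tau>'"
  shows "dominates P Q \<tau> Q' \<tau>' \<longleftrightarrow> kernel G (grp Q) \<tau> \<subseteq> kernel G (grp Q') \<tau>'"
  using limit_pairD[OF assms(1)] limit_pairD[OF assms(2)]
  by (intro dominates_iff_kernel_subset sgp_image_subset G.is_group)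

text \<open>The type of \<open>L\<close> matters: every limit kernel is realized by a group of
  cosets on the type \<open>'g set\<close>, so the competitors in the definition of maximality reach
  all limit kernels.\<close>

lemma maximal_limit_pair_iff:
  fixes T :: "'g set set" and L :: "'g set monoid" and \<tau> :: "'g \<Rightarrow> 'g set"
  assumes L: "limit_pair k P (incl_pair T L) \<tau>"
  shows "maximal_limit_pair k P T L \<tau> \<longleftrightarrow>
    (\<forall>K. limit_kernel k P K \<longrightarrow> K \<subseteq> kernel G L \<tau> \<longrightarrow> kernel G L \<tau> \<subseteq> K)"
proof
  assume max: "maximal_limit_pair k P T L \<tau>"
  show "\<forall>K. limit_kernel k P K \<longrightarrow> K \<subseteq> kernel G L \<tau> \<longrightarrow> kernel G L \<tau> \<subseteq> K"
  proof (intro allI impI)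
    fix K assume K: "limit_kernel k P K" "K \<subseteq> kernel G L \<tau>"
    note lim = limit_kernel_limit_pair(1)[OF K(1)] and ker = limit_kernel_limit_pair(2)[OF K(1)]
    have "dominates P (quotient_pair P K) (quotient_pair_map P K) (incl_pair T L) \<tau>"
      using limit_pair_dominates_iff[OF lim L] ker K(2) by simp
    then have "dominates P (incl_pair T L) \<tau> (quotient_pair P K) (quotient_pair_map P K)"
      using max lim unfolding maximal_limit_pair_def by blast
    then show "kernel G L \<tau> \<subseteq> K" using limit_pair_dominates_iff[OF L lim] ker by simp
  qed
next
  assume min: "\<forall>K. limit_kernel k P K \<longrightarrow> K \<subseteq> kernel G L \<tau> \<longrightarrow> kernel G L \<tau> \<subseteq> K"
  show "maximal_limit_pair k P T L \<tau>"
    unfolding maximal_limit_pair_def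
  proof (intro conjI L allI impI, elim conjE)
    fix T' L' and \<tau>' :: "'g \<Rightarrow> 'g set"
    assume L': "limit_pair k P (incl_pair T' L') \<tau>'"
      and "dominates P (incl_pair T' L') \<tau>' (incl_pair T L) \<tau>"
    then show "dominates P (incl_pair T L) \<tau> (incl_pair T' L') \<tau>'"
      using limit_pair_dominates_iff[OF L' L] limit_pair_dominates_iff[OF L L'] min
        limit_pair_limit_kernel[OF L'] by simp
  qed
qed

text \<open>One coset quotient for each minimal limit kernel, numbered by a bijection; its
  injectivity gives the uniqueness of the index.\<close>

theorem canonical_collection_exists:
  "\<exists>(m :: nat) (T :: nat \<Rightarrow> 'g set set) L \<tau>. canonical_collection k P {1..m} T L \<tau> \<and>
    (\<forall>i\<in>{1..m}. limit_pair k P (incl_pair (T i) (L i)) (\<tau> i)) \<and>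
    (\<forall>h\<in>\<H>. \<exists>i\<in>{1..m}. \<exists>u\<in>pair_hom (incl_pair (T i) (L i)) (free_pair k).
      \<forall>g\<in>carrier G. h g = u (\<tau> i g))"
proof -
  obtain \<M> where \<M>: "finite \<M>"
    "\<And>K. K \<in> \<M> \<longleftrightarrow> limit_kernel k P K \<and> (\<forall>K'. limit_kernel k P K' \<longrightarrow> K' \<subseteq> K \<longrightarrow> K \<subseteq> K')"
    "\<And>h. h \<in> \<H> \<Longrightarrow> \<exists>K\<in>\<M>. kills k h K"
    using finite_minimal_limit_kernels by blast
  obtain K where K: "bij_betw K {1..card \<M>} \<M>" using ex_bij_betw_nat_finite_1[OF \<M>(1)] by blast
  let ?I = "{1..card \<M>}"
  define \<tau> where "\<tau> i = quotient_pair_map P (K i)" for i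
  define T where "T i = \<tau> i ` sgp_image P" for i
  define L where "L i = G Mod K i" for i
  have KM: "K i \<in> \<M>" if "i \<in> ?I" for i using K that by (auto simp: bij_betw_def)
  then have lk: "limit_kernel k P (K i)" if "i \<in> ?I" for i using that \<M>(2) by blast
  have lim: "limit_pair k P (incl_pair (T i) (L i)) (\<tau> i)" and ker: "kernel G (L i) (\<tau> i) = K i"
    if "i \<in> ?I" for i
    using limit_kernel_limit_pair[OF lk[OF that]] by (simp_all add: T_def L_def \<tau>_def)
  have "canonical_collection k P ?I T L \<tau>"
    unfolding canonical_collection_def
  proof (intro conjI ballI allI impI)
    fix i assume i: "i \<in> ?I"
    show "maximal_limit_pair k P (T i) (L i) (\<tau> i)"
      using maximal_limit_pair_iff[OF lim[OF i]] ker[OF i] KM[OF i] \<M>(2)[of "K i"] by simp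
  next
    fix T' L' and \<tau>' :: "'g \<Rightarrow> 'g set"
    assume max: "maximal_limit_pair k P T' L' \<tau>'"
    then have L': "limit_pair k P (incl_pair T' L') \<tau>'" by (simp add: maximal_limit_pair_def)
    let ?K' = "kernel G L' \<tau>'"
    have "?K' \<in> \<M>"
      using maximal_limit_pair_iff[OF L'] max limit_pair_limit_kernel[OF L'] \<M>(2)[of ?K'] by simp
    then have "?K' \<in> K ` ?I" using bij_betw_imp_surj_on[OF K] by (simp only:)
    then obtain i where i: "i \<in> ?I" "?K' = K i" by (rule imageE)
    have dom: "dominates P (incl_pair (T j) (L j)) (\<tau> j) (incl_pair T' L') \<tau>' \<and>
        dominates P (incl_pair T' L') \<tau>' (incl_pair (T j) (L j)) (\<tau> j) \<longleftrightarrow> K j = K i"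
      if "j \<in> ?I" for j
      using limit_pair_dominates_iff[OF lim[OF that] L'] limit_pair_dominates_iff[OF L' lim[OF that]]
        ker[OF that] i(2) by auto
    show "\<exists>!i. i \<in> ?I \<and>
        dominates P (incl_pair (T i) (L i)) (\<tau> i) (incl_pair T' L') \<tau>' \<and>
        dominates P (incl_pair T' L') \<tau>' (incl_pair (T i) (L i)) (\<tau> i)"
    proof (rule ex1I[of _ i])
      show "i \<in> ?I \<and> dominates P (incl_pair (T i) (L i)) (\<tau> i) (incl_pair T' L') \<tau>' \<and>
          dominates P (incl_pair T' L') \<tau>' (incl_pair (T i) (L i)) (\<tau> i)"
        using dom[OF i(1)] i(1) by blast
      fix j assume "j \<in> ?I \<and> dominates P (incl_pair (T j) (L j)) (\<tau> j) (incl_pair T' L') \<tau>' \<and>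
          dominates P (incl_pair T' L') \<tau>' (incl_pair (T j) (L j)) (\<tau> j)"
      then show "j = i" using dom[of j] inj_onD[OF bij_betw_imp_inj_on[OF K], of j i] i(1) by blast
    qed
  qed
  moreover have "\<exists>i\<in>?I. \<exists>u\<in>pair_hom (incl_pair (T i) (L i)) (free_pair k).
      \<forall>g\<in>carrier G. h g = u (\<tau> i g)" if h: "h \<in> \<H>" for h
  proof -
    obtain K' where K': "K' \<in> \<M>" "kills k h K'" using \<M>(3)[OF h] by blast
    have "K' \<in> K ` ?I" using bij_betw_imp_surj_on[OF K] K'(1) by (simp only:)
    then obtain i where "i \<in> ?I" "K' = K i" by (rule imageE)
    with K' have i: "i \<in> ?I" "kills k h (K i)" by simp_all
    have "group (grp (free_pair k))" by (simp add: free_pair_def group_free_group)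
    moreover have "kernel G (grp (incl_pair (T i) (L i))) (\<tau> i) \<subseteq> kernel G (grp (free_pair k)) h"
      using i ker[OF i(1)] lk[OF i(1)]
      by (auto simp: limit_kernel_def kernel_def kills_def free_pair_def)
    ultimately show ?thesis
      using i(1) by (intro bexI[of _ i] pair_quotient_map_factor[OF G.is_group limit_pairD(1)[OF lim[OF i(1)]] _
          limit_pairD(2)[OF lim[OF i(1)]] h sgp_image_subset])
  qed
  ultimately show ?thesis
    using lim by (intro exI[of _ "card \<M>"] exI[of _ T] exI[of _ L] exI[of _ \<tau>] conjI ballI)
qed

end

section \<open>The group of a presented semigroup\<close>

lemma pos_word_simps [simp]:
  "pos_word [] = []" "pos_word (x # w) = (True, x) # pos_word w"
  "pos_word (u @ v) = pos_word u @ pos_word v"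
  by (simp_all add: pos_word_def)

lemma pos_word_in_lists: "w \<in> lists X \<Longrightarrow> pos_word w \<in> lists (UNIV \<times> X)"
  by (induction w) auto

lemma free_incl_append:
  assumes "u \<in> lists Y" "v \<in> lists Y"
  shows "free_incl Y (u @ v) = free_incl Y u \<otimes>\<^bsub>free_group Y\<^esub> free_incl Y v"
  unfolding free_incl_def free_group_def
  using word_class_mult[of "{}" Y "pos_word u" "pos_word v"] assms by (simp add: pos_word_in_lists)

lemma free_incl_in_carrier:
  "u \<in> lists Y \<Longrightarrow> free_incl Y u \<in> carrier (free_group Y)"
  unfolding free_incl_def free_group_def by (intro word_class_in_carrier pos_word_in_lists) simp

abbreviation sgp_class :: "'x set \<Rightarrow> ('x list \<times> 'x list) set \<Rightarrow> 'x list \<Rightarrow> 'x list set" where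
  "sgp_class X R w \<equiv> semigroup_cong X R `` {w}"

locale presented_semigroup_iso =
  fixes S :: "'s monoid" and X :: "'x set" and R :: "('x list \<times> 'x list) set"
    and \<psi> :: "'s \<Rightarrow> 'x list set"
  assumes S: "is_semigroup S" and R: "semigroup_relations X R"
    and \<psi>: "\<psi> \<in> iso S (presented_semigroup X R)"
begin

lemma pos_rels: "pos_rels R \<subseteq> lists (UNIV \<times> X) \<times> lists (UNIV \<times> X)"
proof
  fix p assume "p \<in> pos_rels R"
  then obtain u v where "(u, v) \<in> R" "p = (pos_word u, pos_word v)" by (auto simp: pos_rels_def)
  then show "p \<in> lists (UNIV \<times> X) \<times> lists (UNIV \<times> X)"
    using R pos_word_in_lists[of u X] pos_word_in_lists[of v X] by (auto simp: semigroup_relations_def)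
qed

lemma semigroup_cong_in_lists:
  "(u, v) \<in> semigroup_cong X R \<Longrightarrow> u \<in> lists X - {[]} \<and> v \<in> lists X - {[]}"
proof (induction rule: semigroup_cong.induct)
  case (rel u v)
  then show ?case using R by (auto simp: semigroup_relations_def)
qed simp_all

lemma equiv_semigroup_cong: "equiv (lists X - {[]}) (semigroup_cong X R)"
proof (rule equivI)
  show "semigroup_cong X R \<subseteq> (lists X - {[]}) \<times> (lists X - {[]})"
    using semigroup_cong_in_lists by (intro subrelI) blast
  show "refl_on (lists X - {[]}) (semigroup_cong X R)"
    by (rule refl_onI) (rule semigroup_cong.refl)
  show "sym (semigroup_cong X R)" by (rule symI) (rule semigroup_cong.sym)
  show "trans (semigroup_cong X R)" by (rule transI) (rule semigroup_cong.trans)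
qed

text \<open>Every rule of the semigroup congruence is matched by one of the group congruence. This
  makes \<open>eta\<close> well defined.\<close>

lemma semigroup_cong_imp_group_cong:
  "(u, v) \<in> semigroup_cong X R \<Longrightarrow> (pos_word u, pos_word v) \<in> group_cong X (pos_rels R)"
proof (induction rule: semigroup_cong.induct)
  case (rel u v)
  then show ?case by (intro group_cong.rel) (force simp: pos_rels_def)
next
  case (refl w)
  then show ?case by (intro group_cong.refl pos_word_in_lists) simp
next
  case (sym u v)
  then show ?case by (blast intro: group_cong.sym)
next
  case (trans u v w)
  then show ?case by (blast intro: group_cong.trans)
next
  case (mult u v u' v')
  then show ?case unfolding pos_word_simps by (intro group_cong.mult)
qed

lemma sgp_class_mult:
  assumes "u \<in> lists X - {[]}" "v \<in> lists X - {[]}"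
  shows "sgp_class X R u \<otimes>\<^bsub>presented_semigroup X R\<^esub> sgp_class X R v = sgp_class X R (u @ v)"
proof -
  have "sgp_class X R (a @ b) = sgp_class X R (u @ v)"
    if "a \<in> sgp_class X R u" "b \<in> sgp_class X R v" for a b
    using that semigroup_cong.mult[of u a X R v b] equiv_class_eq[OF equiv_semigroup_cong] by simp
  moreover have "u \<in> sgp_class X R u" "v \<in> sgp_class X R v"
    using assms by (auto intro: semigroup_cong.refl)
  ultimately have "(\<Union>a\<in>sgp_class X R u. \<Union>b\<in>sgp_class X R v. sgp_class X R (a @ b)) =
      sgp_class X R (u @ v)"
    by (intro UN_constant_eq ballI)
  then show ?thesis by (simp add: presented_semigroup_def)
qed

lemma \<psi>_bij: "bij_betw \<psi> (carrier S) ((lists X - {[]}) // semigroup_cong X R)"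
  using \<psi> by (simp add: iso_def presented_semigroup_def)

lemma representative:
  assumes "s \<in> carrier S"
  obtains w where "w \<in> lists X - {[]}" "\<psi> s = sgp_class X R w"
proof -
  have "\<psi> s \<in> (lists X - {[]}) // semigroup_cong X R" using \<psi>_bij assms by (auto simp: bij_betw_def)
  then show thesis using that by (elim quotientE)
qed

lemma element_of_word:
  assumes "w \<in> lists X - {[]}"
  obtains s where "s \<in> carrier S" "\<psi> s = sgp_class X R w"
proof -
  have "sgp_class X R w \<in> \<psi> ` carrier S"
    using \<psi>_bij quotientI[OF assms, of "semigroup_cong X R"] by (simp add: bij_betw_def)
  then show thesis using that by (metis imageE)
qed

lemma \<psi>_mult:
  assumes "s \<in> carrier S" "t \<in> carrier S" "\<psi> s = sgp_class X R u" "\<psi> t = sgp_class X R v"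
    "u \<in> lists X - {[]}" "v \<in> lists X - {[]}"
  shows "\<psi> (s \<otimes>\<^bsub>S\<^esub> t) = sgp_class X R (u @ v)"
proof -
  have "\<psi> \<in> hom S (presented_semigroup X R)" using \<psi> by (simp add: iso_def)
  then show ?thesis using assms by (simp add: hom_mult sgp_class_mult del: Diff_iff)
qed

lemma eta_word:
  assumes "w \<in> lists X - {[]}" "\<psi> s = sgp_class X R w"
  shows "eta X R \<psi> s = word_class X (pos_rels R) (pos_word w)"
  unfolding eta_def assms(2)
proof (intro UN_constant_eq ballI)
  show "w \<in> sgp_class X R w" using assms(1) by (auto intro: semigroup_cong.refl)
  fix v assume "v \<in> sgp_class X R w"
  then have "(pos_word w, pos_word v) \<in> group_cong X (pos_rels R)"
    using semigroup_cong_imp_group_cong by simp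
  then show "word_class X (pos_rels R) (pos_word v) = word_class X (pos_rels R) (pos_word w)"
    using equiv_class_eq[OF equiv_group_cong[OF pos_rels]] by simp
qed

section \<open>The pair of a presented semigroup, and extension of homomorphisms to it\<close>

lemma group_Gr: "group (Gr X R)"
  unfolding Gr_def by (rule group_presented_group[OF pos_rels])

lemma eta_hom: "eta X R \<psi> \<in> hom S (Gr X R)"
proof (rule homI)
  fix s assume "s \<in> carrier S"
  then obtain w where w: "w \<in> lists X - {[]}" "\<psi> s = sgp_class X R w" by (rule representative)
  then have "pos_word w \<in> lists (UNIV \<times> X)" by (intro pos_word_in_lists) simp
  then show "eta X R \<psi> s \<in> carrier (Gr X R)"
    unfolding eta_word[OF w] Gr_def by (rule word_class_in_carrier[OF pos_rels])
next
  fix s t assume st: "s \<in> carrier S" "t \<in> carrier S"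
  obtain u where u: "u \<in> lists X - {[]}" "\<psi> s = sgp_class X R u" using st(1) by (rule representative)
  obtain v where v: "v \<in> lists X - {[]}" "\<psi> t = sgp_class X R v" using st(2) by (rule representative)
  have uv: "pos_word u \<in> lists (UNIV \<times> X)" "pos_word v \<in> lists (UNIV \<times> X)"
    using u v by (auto intro!: pos_word_in_lists)
  have "u @ v \<in> lists X - {[]}" using u v by simp
  from eta_word[OF this \<psi>_mult[OF st u(2) v(2) u(1) v(1)]]
  show "eta X R \<psi> (s \<otimes>\<^bsub>S\<^esub> t) = eta X R \<psi> s \<otimes>\<^bsub>Gr X R\<^esub> eta X R \<psi> t"
    unfolding eta_word[OF u] eta_word[OF v] Gr_def word_class_mult[OF pos_rels uv] by simp
qed

lemma generate_eta: "generate (Gr X R) (eta X R \<psi> ` carrier S) = carrier (Gr X R)"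
  unfolding Gr_def
proof (rule generate_presented_group[OF pos_rels])
  show "eta X R \<psi> ` carrier S \<subseteq> carrier (presented_group X (pos_rels R))"
    using hom_in_carrier[OF eta_hom] unfolding Gr_def by blast
  fix x assume "x \<in> X"
  then have x: "[x] \<in> lists X - {[]}" by simp
  then obtain s where s: "s \<in> carrier S" "\<psi> s = sgp_class X R [x]" by (rule element_of_word)
  then show "word_class X (pos_rels R) [(True, x)] \<in> eta X R \<psi> ` carrier S"
    using eta_word[OF x s(2)] by (intro image_eqI[of _ _ s]) simp_all
qed

lemma is_pair_Gr_pair: "is_pair (Gr_pair S X R \<psi>)"
  unfolding is_pair_def Gr_pair_def using S group_Gr eta_hom generate_eta by simp

text \<open>The alphabet \<open>X\<close> may be infinite, so the generators are taken from
  \<open>S\<close>: the subgroup generated by their images contains the image of \<open>S\<close>,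
  which generates everything.\<close>

lemma fg_Gr:
  assumes "fg_semigroup S"
  shows "fg_group (Gr X R)"
proof -
  obtain A where A: "finite A" "A \<subseteq> carrier S" "semigroup_span S A = carrier S"
    using assms by (auto simp: fg_semigroup_def)
  interpret Gr: group "Gr X R" by (rule group_Gr)
  let ?B = "eta X R \<psi> ` A"
  have B: "?B \<subseteq> carrier (Gr X R)" using A(2) hom_in_carrier[OF eta_hom] by blast
  have "s \<in> carrier S \<and> eta X R \<psi> s \<in> generate (Gr X R) ?B" if "s \<in> semigroup_span S A" for s
    using that
  proof (induction rule: semigroup_span.induct)
    case (incl a)
    then show ?case using A(2) by (auto intro: generate.incl)
  next
    case (mult a b)
    then show ?case
      using S hom_mult[OF eta_hom, of a b] by (auto simp: is_semigroup_def intro: generate.eng)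
  qed
  then have "eta X R \<psi> ` carrier S \<subseteq> generate (Gr X R) ?B" unfolding A(3) by blast
  then have "generate (Gr X R) (eta X R \<psi> ` carrier S) \<subseteq> generate (Gr X R) ?B"
    by (rule Gr.generate_subgroup_incl[OF _ Gr.generate_is_subgroup[OF B]])
  then have "generate (Gr X R) ?B = carrier (Gr X R)"
    unfolding generate_eta using Gr.generate_incl[OF B] by (intro subset_antisym)
  then show ?thesis using A(1) B by (auto simp: fg_group_def intro!: exI[of _ ?B])
qed

text \<open>Von Dyck's theorem with each letter sent to the value of \<open>h\<close> on the element
  it represents. The relations hold because the two sides of a relator represent the same element of
  \<open>S\<close>.\<close>

lemma extend_to_pair_hom:
  fixes k :: nat
  assumes h: "h \<in> hom S (free_semigroup {..<k})"
  shows "\<exists>h\<^sub>P\<in>pair_hom (Gr_pair S X R \<psi>) (free_pair k).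
    \<forall>s\<in>carrier S. h\<^sub>P (eta X R \<psi> s) = free_incl {..<k} (h s)"
proof -
  let ?F = "free_group {..<k}"
  interpret F: group ?F by (rule group_free_group)
  \<comment> \<open>\<open>h\<close> transported to words: \<open>g w\<close> is the value of
    \<open>h\<close> on the element represented by \<open>w\<close>.\<close>
  define g where "g w = h (inv_into (carrier S) \<psi> (sgp_class X R w))" for w
  have g: "g w = h s" if "s \<in> carrier S" "\<psi> s = sgp_class X R w" for s w
    unfolding g_def that(2)[symmetric] using \<psi>_bij that(1) by (simp add: bij_betw_def inv_into_f_f)
  have hS: "h s \<in> lists {..<k} - {[]}" if "s \<in> carrier S" for s
    using hom_in_carrier[OF h that] by (simp add: free_semigroup_def)
  have g_closed: "g w \<in> lists {..<k}" if "w \<in> lists X - {[]}" for w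
    using that g hS by (metis DiffD1 element_of_word)
  have g_append: "g (u @ v) = g u @ g v" if uv: "u \<in> lists X - {[]}" "v \<in> lists X - {[]}" for u v
  proof -
    obtain s where s: "s \<in> carrier S" "\<psi> s = sgp_class X R u" using uv(1) by (rule element_of_word)
    obtain t where t: "t \<in> carrier S" "\<psi> t = sgp_class X R v" using uv(2) by (rule element_of_word)
    have "s \<otimes>\<^bsub>S\<^esub> t \<in> carrier S" using S s t by (simp add: is_semigroup_def)
    then have "g (u @ v) = h (s \<otimes>\<^bsub>S\<^esub> t)" using \<psi>_mult[OF s(1) t(1) s(2) t(2) uv] by (rule g)
    also have "\<dots> = h s @ h t" using hom_mult[OF h s(1) t(1)] by (simp add: free_semigroup_def)
    finally show ?thesis using g[OF s] g[OF t] by simp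
  qed
  define f where "f x = free_incl {..<k} (g [x])" for x
  have f: "f x \<in> carrier ?F" if "x \<in> X" for x
    unfolding f_def using g_closed[of "[x]"] that by (intro free_incl_in_carrier) simp
  define ev where "ev w = foldr (\<lambda>(b, x) a. (if b then f x else inv\<^bsub>?F\<^esub> f x) \<otimes>\<^bsub>?F\<^esub> a) w \<one>\<^bsub>?F\<^esub>" for w
  \<comment> \<open>The induction bottoms out at one-letter words, since the empty word represents
    no element of \<open>S\<close>.\<close>
  have ev_pos: "ev (pos_word w) = free_incl {..<k} (g w)" if "w \<in> lists X - {[]}" for w
    using that
  proof (induction w)
    case (Cons x w)
    show ?case
    proof (cases "w = []")
      case True
      then show ?thesis using Cons f[of x] by (simp add: ev_def f_def)
    next
      case False
      then have w: "w \<in> lists X - {[]}" "[x] \<in> lists X - {[]}" using Cons by auto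
      have "ev (pos_word (x # w)) = f x \<otimes>\<^bsub>?F\<^esub> ev (pos_word w)" by (simp add: ev_def)
      also have "\<dots> = free_incl {..<k} (g [x]) \<otimes>\<^bsub>?F\<^esub> free_incl {..<k} (g w)"
        using Cons.IH[OF w(1)] by (simp add: f_def)
      also have "\<dots> = free_incl {..<k} (g [x] @ g w)"
        using g_closed[OF w(1)] g_closed[OF w(2)] by (simp add: free_incl_append)
      also have "g [x] @ g w = g (x # w)" using g_append[OF w(2,1)] by simp
      finally show ?thesis .
    qed
  qed simp
  have ev_rels: "ev u = ev v" if uv: "(u, v) \<in> pos_rels R" for u v
  proof -
    obtain a b where ab: "(a, b) \<in> R" "u = pos_word a" "v = pos_word b"
      using uv by (auto simp: pos_rels_def)
    have "(a, b) \<in> semigroup_cong X R" using ab(1) by (rule semigroup_cong.rel)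
    then have "sgp_class X R a = sgp_class X R b" "a \<in> lists X - {[]}" "b \<in> lists X - {[]}"
      using semigroup_cong_in_lists equiv_class_eq[OF equiv_semigroup_cong] by blast+
    then show ?thesis using ab ev_pos by (simp add: g_def)
  qed
  have "\<exists>H\<in>hom (Gr X R) ?F. \<forall>w\<in>lists (UNIV \<times> X). H (word_class X (pos_rels R) w) = ev w"
    unfolding Gr_def ev_def
    by (rule presented_group_lift[where f = f, OF pos_rels group_free_group f ev_rels[unfolded ev_def]])
  then obtain H where H: "H \<in> hom (Gr X R) ?F"
    "\<And>w. w \<in> lists (UNIV \<times> X) \<Longrightarrow> H (word_class X (pos_rels R) w) = ev w"
    by blast
  have H_eta: "H (eta X R \<psi> s) = free_incl {..<k} (h s)" if "s \<in> carrier S" for s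
    using that
  proof (rule representative)
    fix w assume w: "w \<in> lists X - {[]}" "\<psi> s = sgp_class X R w"
    then show ?thesis
      using eta_word[OF w] ev_pos[OF w(1)] g[OF that w(2)] H(2)[of "pos_word w"]
      by (simp add: pos_word_in_lists)
  qed
  have "H \<in> pair_hom (Gr_pair S X R \<psi>) (free_pair k)"
    using H(1) H_eta hS
    by (auto simp: pair_hom_def Gr_pair_def free_pair_def sgp_image_def free_semigroup_def)
  with H_eta show ?thesis by blast
qed

end

theorem theorem1p1:
  fixes S :: "'s monoid"
    and X :: "'x set" and R :: "('x list \<times> 'x list) set" and \<psi> :: "'s \<Rightarrow> 'x list set"
    and k :: nat
  assumes "fg_semigroup S"
    and "semigroup_relations X R"
    and "\<psi> \<in> iso S (presented_semigroup X R)"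
    and "k \<ge> 1"
  shows "\<exists>(m :: nat) (T :: nat \<Rightarrow> 'x gword set set set) (L :: nat \<Rightarrow> 'x gword set set monoid)
           (\<tau> :: nat \<Rightarrow> 'x gword set \<Rightarrow> 'x gword set set).
    canonical_collection k (Gr_pair S X R \<psi>) {1..m} T L \<tau> \<and>
    (\<forall>i\<in>{1..m}.
       limit_group (L i) \<and>
       subsemigroup (T i) (L i) \<and>
       generate (L i) (T i) = carrier (L i) \<and>
       limit_pair k (Gr_pair S X R \<psi>) (incl_pair (T i) (L i)) (\<tau> i) \<and>
       \<tau> i \<in> pair_quotient_map (Gr_pair S X R \<psi>) (incl_pair (T i) (L i))) \<and>
    (\<forall>h\<in>hom S (free_semigroup {..<k}).
       (\<exists>h\<^sub>P\<in>pair_hom (Gr_pair S X R \<psi>) (free_pair k).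
          \<forall>s\<in>carrier S. h\<^sub>P (eta X R \<psi> s) = free_incl {..<k} (h s)) \<and>
       (\<forall>h\<^sub>P\<in>pair_hom (Gr_pair S X R \<psi>) (free_pair k).
          (\<forall>s\<in>carrier S. h\<^sub>P (eta X R \<psi> s) = free_incl {..<k} (h s)) \<longrightarrow>
          (\<exists>i\<in>{1..m}. \<exists>u\<in>pair_hom (incl_pair (T i) (L i)) (free_pair k).
             \<forall>g\<in>carrier (Gr X R). h\<^sub>P g = u (\<tau> i g))))"
proof -
  let ?P = "Gr_pair S X R \<psi>"
  interpret presented_semigroup_iso S X R \<psi>
    using assms by unfold_locales (simp_all add: fg_semigroup_def)
  have grp: "grp ?P = Gr X R" by (simp add: Gr_pair_def)
  interpret fg_pair ?P k
    using is_pair_Gr_pair fg_Gr[OF assms(1)] by unfold_locales (simp_all only: grp)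
  obtain m :: nat and T :: "nat \<Rightarrow> 'x gword set set set" and L :: "nat \<Rightarrow> 'x gword set set monoid"
      and \<tau> :: "nat \<Rightarrow> 'x gword set \<Rightarrow> 'x gword set set" where m:
    "canonical_collection k ?P {1..m} T L \<tau>"
    "\<forall>i\<in>{1..m}. limit_pair k ?P (incl_pair (T i) (L i)) (\<tau> i)"
    "\<forall>h\<in>pair_hom ?P (free_pair k). \<exists>i\<in>{1..m}.
      \<exists>u\<in>pair_hom (incl_pair (T i) (L i)) (free_pair k). \<forall>g\<in>carrier (Gr X R). h g = u (\<tau> i g)"
    using canonical_collection_exists unfolding grp by (elim exE conjE)
  have incl: "subsemigroup T' L' \<and> generate L' T' = carrier L'"
    if "is_pair (incl_pair T' L')" for T' and L' :: "'x gword set set monoid"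
    using that
    by (auto simp: is_pair_def incl_pair_def subsemigroup_def is_semigroup_def hom_def)
  show ?thesis
  proof (intro exI conjI ballI impI)
    show "canonical_collection k ?P {1..m} T L \<tau>" by (rule m(1))
    fix i assume i: "i \<in> {1..m}"
    note lim = bspec[OF m(2) i]
    show "limit_pair k ?P (incl_pair (T i) (L i)) (\<tau> i)" by (rule lim)
    show "limit_group (L i)" "\<tau> i \<in> pair_quotient_map ?P (incl_pair (T i) (L i))"
      using lim by (simp_all add: limit_pair_def)
    show "subsemigroup (T i) (L i)" "generate (L i) (T i) = carrier (L i)"
      using incl lim by (simp_all add: limit_pair_def)
  next
    fix h assume "h \<in> hom S (free_semigroup {..<k})"
    then show "\<exists>h\<^sub>P\<in>pair_hom ?P (free_pair k).
        \<forall>s\<in>carrier S. h\<^sub>P (eta X R \<psi> s) = free_incl {..<k} (h s)"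
      by (rule extend_to_pair_hom)
  next
    \<comment> \<open>The collection factors every pair homomorphism, in particular each extension
      of \<open>h\<close>.\<close>
    fix h\<^sub>P assume "h\<^sub>P \<in> pair_hom ?P (free_pair k)"
    then show "\<exists>i\<in>{1..m}. \<exists>u\<in>pair_hom (incl_pair (T i) (L i)) (free_pair k).
        \<forall>g\<in>carrier (Gr X R). h\<^sub>P g = u (\<tau> i g)"
      by (rule bspec[OF m(3)])
  qed
qed

end
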